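(* Let $\mathbf{C}$ be a regular Mal'cev category. Then $\mathbf{Rel}(\mathbf{C})$ satisfies the bottleneck principle: for every relation $R\colon A\to B$ in $\mathbf{Rel}(\mathbf{C})$, if there exist $\psi,\phi\colon I\to A$ with $R^\dagger\circ R=\psi\circ\phi^\dagger$, then there exist $\phi\colon I\to A$ and $\psi\colon I\to B$ with $R=\psi\circ\phi^\dagger$.
   Context: A category is regular when it has finite limits, coequalizers of kernel pairs, and regular epimorphisms are stable under pullback. A category with finite limits is Mal'cev if every reflexive relation $R\rightarrowtail A\times A$ is an equivalence relation. For $\mathbf{C}$ regular, $\mathbf{Rel}(\mathbf{C})$ has the same objects as $\mathbf{C}$; a morphism (relation) $R\colon A\to B$ is a subobject $R\rightarrowtail A\times B$; identities are diagonals; $S\circ R$ is the image of $R\times_B S\to A\times C$, i.e. $\{(a,c)\mid (\exists b)\,R(a,b)\wedge S(b,c)\}$ in the internal regular logic. $\mathbf{Rel}(\mathbf{C})$ is a dagger monoidal category with $\otimes=\times$, unit $I=1$ the terminal object of $\mathbf{C}$, and $R^\dagger(b,a)\Leftrightarrow R(a,b)$. *)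

theory Defs
  imports Main
begin

record ('o, 'a) cat =
  Ob :: "'o set"
  Ar :: "'a set"
  Dom :: "'a \<Rightarrow> 'o"
  Cod :: "'a \<Rightarrow> 'o"
  Ide :: "'o \<Rightarrow> 'a"
  Comp :: "'a \<Rightarrow> 'a \<Rightarrow> 'a"  (infixl "\<cdot>\<index>" 70)

definition hom :: "('o, 'a) cat \<Rightarrow> 'o \<Rightarrow> 'o \<Rightarrow> 'a set" where
  "hom C A B = {f \<in> Ar C. Dom C f = A \<and> Cod C f = B}"

text \<open>Composition is written in the order \<open>g \<cdot> f\<close> (first \<open>f\<close>, then \<open>g\<close>) and is
  unspecified on non-composable pairs.\<close>

locale category =
  fixes C :: "('o, 'a) cat" (structure)
  assumes Dom_in_Ob: "f \<in> Ar C \<Longrightarrow> Dom C f \<in> Ob C"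
    and Cod_in_Ob: "f \<in> Ar C \<Longrightarrow> Cod C f \<in> Ob C"
    and Ide_in_hom: "A \<in> Ob C \<Longrightarrow> Ide C A \<in> hom C A A"
    and Comp_in_hom: "f \<in> hom C A B \<Longrightarrow> g \<in> hom C B D \<Longrightarrow> g \<cdot> f \<in> hom C A D"
    and Comp_Ide: "f \<in> hom C A B \<Longrightarrow> f \<cdot> Ide C A = f"
    and Ide_Comp: "f \<in> hom C A B \<Longrightarrow> Ide C B \<cdot> f = f"
    and Comp_assoc: "f \<in> hom C A B \<Longrightarrow> g \<in> hom C B D \<Longrightarrow> h \<in> hom C D E \<Longrightarrow>
      (h \<cdot> g) \<cdot> f = h \<cdot> (g \<cdot> f)"


section \<open>Limits and colimits\<close>

definition is_functor ::
  "('j, 'u) cat \<Rightarrow> ('o, 'a) cat \<Rightarrow> ('j \<Rightarrow> 'o) \<Rightarrow> ('u \<Rightarrow> 'a) \<Rightarrow> bool" where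
  "is_functor J C Fo Fa \<longleftrightarrow> category J \<and> category C \<and>
     (\<forall>j\<in>Ob J. Fo j \<in> Ob C) \<and>
     (\<forall>u\<in>Ar J. Fa u \<in> hom C (Fo (Dom J u)) (Fo (Cod J u))) \<and>
     (\<forall>j\<in>Ob J. Fa (Ide J j) = Ide C (Fo j)) \<and>
     (\<forall>u\<in>Ar J. \<forall>v\<in>Ar J. Cod J u = Dom J v \<longrightarrow> Fa (v \<cdot>\<^bsub>J\<^esub> u) = Fa v \<cdot>\<^bsub>C\<^esub> Fa u)"

definition is_cone ::
  "('j, 'u) cat \<Rightarrow> ('o, 'a) cat \<Rightarrow> ('j \<Rightarrow> 'o) \<Rightarrow> ('u \<Rightarrow> 'a) \<Rightarrow> 'o \<Rightarrow> ('j \<Rightarrow> 'a) \<Rightarrow> bool" where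
  "is_cone J C Fo Fa X l \<longleftrightarrow> X \<in> Ob C \<and>
     (\<forall>j\<in>Ob J. l j \<in> hom C X (Fo j)) \<and>
     (\<forall>u\<in>Ar J. Fa u \<cdot>\<^bsub>C\<^esub> l (Dom J u) = l (Cod J u))"

definition is_limit ::
  "('j, 'u) cat \<Rightarrow> ('o, 'a) cat \<Rightarrow> ('j \<Rightarrow> 'o) \<Rightarrow> ('u \<Rightarrow> 'a) \<Rightarrow> 'o \<Rightarrow> ('j \<Rightarrow> 'a) \<Rightarrow> bool" where
  "is_limit J C Fo Fa X l \<longleftrightarrow> is_cone J C Fo Fa X l \<and>
     (\<forall>Y k. is_cone J C Fo Fa Y k \<longrightarrow>
        (\<exists>!h. h \<in> hom C Y X \<and> (\<forall>j\<in>Ob J. l j \<cdot>\<^bsub>C\<^esub> h = k j)))"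

text \<open>Every finite category is isomorphic to one whose objects and arrows are natural
  numbers, so quantifying over such index categories is no restriction.\<close>

definition has_finite_limits :: "('o, 'a) cat \<Rightarrow> bool" where
  "has_finite_limits C \<longleftrightarrow>
     (\<forall>(J :: (nat, nat) cat) Fo Fa. finite (Ob J) \<and> finite (Ar J) \<and> is_functor J C Fo Fa \<longrightarrow>
        (\<exists>X l. is_limit J C Fo Fa X l))"

definition is_terminal :: "('o, 'a) cat \<Rightarrow> 'o \<Rightarrow> bool" where
  "is_terminal C T \<longleftrightarrow> T \<in> Ob C \<and> (\<forall>X\<in>Ob C. \<exists>!h. h \<in> hom C X T)"

definition is_product :: "('o, 'a) cat \<Rightarrow> 'o \<Rightarrow> 'o \<Rightarrow> 'o \<Rightarrow> 'a \<Rightarrow> 'a \<Rightarrow> bool" where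
  "is_product C A B P p q \<longleftrightarrow> P \<in> Ob C \<and> p \<in> hom C P A \<and> q \<in> hom C P B \<and>
     (\<forall>X. \<forall>a\<in>hom C X A. \<forall>b\<in>hom C X B.
        \<exists>!h. h \<in> hom C X P \<and> p \<cdot>\<^bsub>C\<^esub> h = a \<and> q \<cdot>\<^bsub>C\<^esub> h = b)"

text \<open>The square \<open>f \<cdot> u = g \<cdot> v\<close> is a pullback; its apex is \<open>Dom C u = Dom C v\<close>.\<close>

definition is_pullback :: "('o, 'a) cat \<Rightarrow> 'a \<Rightarrow> 'a \<Rightarrow> 'a \<Rightarrow> 'a \<Rightarrow> bool" where
  "is_pullback C f g u v \<longleftrightarrow>
     f \<in> Ar C \<and> g \<in> Ar C \<and> Cod C f = Cod C g \<and>
     u \<in> Ar C \<and> v \<in> Ar C \<and> Dom C u = Dom C v \<and> Cod C u = Dom C f \<and> Cod C v = Dom C g \<and>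
     f \<cdot>\<^bsub>C\<^esub> u = g \<cdot>\<^bsub>C\<^esub> v \<and>
     (\<forall>X. \<forall>a\<in>hom C X (Dom C f). \<forall>b\<in>hom C X (Dom C g). f \<cdot>\<^bsub>C\<^esub> a = g \<cdot>\<^bsub>C\<^esub> b \<longrightarrow>
        (\<exists>!h. h \<in> hom C X (Dom C u) \<and> u \<cdot>\<^bsub>C\<^esub> h = a \<and> v \<cdot>\<^bsub>C\<^esub> h = b))"

definition is_coequalizer :: "('o, 'a) cat \<Rightarrow> 'a \<Rightarrow> 'a \<Rightarrow> 'a \<Rightarrow> bool" where
  "is_coequalizer C f g e \<longleftrightarrow>
     f \<in> Ar C \<and> g \<in> Ar C \<and> Dom C f = Dom C g \<and> Cod C f = Cod C g \<and>
     e \<in> Ar C \<and> Dom C e = Cod C f \<and> e \<cdot>\<^bsub>C\<^esub> f = e \<cdot>\<^bsub>C\<^esub> g \<and>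
     (\<forall>h\<in>Ar C. Dom C h = Cod C f \<and> h \<cdot>\<^bsub>C\<^esub> f = h \<cdot>\<^bsub>C\<^esub> g \<longrightarrow>
        (\<exists>!k. k \<in> hom C (Cod C e) (Cod C h) \<and> k \<cdot>\<^bsub>C\<^esub> e = h))"

definition is_kernel_pair :: "('o, 'a) cat \<Rightarrow> 'a \<Rightarrow> 'a \<Rightarrow> 'a \<Rightarrow> bool" where
  "is_kernel_pair C f u v \<longleftrightarrow> is_pullback C f f u v"

definition regular_epi :: "('o, 'a) cat \<Rightarrow> 'a \<Rightarrow> bool" where
  "regular_epi C e \<longleftrightarrow> (\<exists>f g. is_coequalizer C f g e)"

definition monic :: "('o, 'a) cat \<Rightarrow> 'a \<Rightarrow> bool" where
  "monic C m \<longleftrightarrow> m \<in> Ar C \<and>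
     (\<forall>X. \<forall>f\<in>hom C X (Dom C m). \<forall>g\<in>hom C X (Dom C m). m \<cdot>\<^bsub>C\<^esub> f = m \<cdot>\<^bsub>C\<^esub> g \<longrightarrow> f = g)"

definition regular_category :: "('o, 'a) cat \<Rightarrow> bool" where
  "regular_category C \<longleftrightarrow> category C \<and> has_finite_limits C \<and>
     (\<forall>f u v. is_kernel_pair C f u v \<longrightarrow> (\<exists>e. is_coequalizer C u v e)) \<and>
     (\<forall>f g u v. regular_epi C f \<and> is_pullback C f g u v \<longrightarrow> regular_epi C v)"


section \<open>Chosen terminal object and binary products\<close>

definition one :: "('o, 'a) cat \<Rightarrow> 'o" where
  "one C = (SOME T. is_terminal C T)"

definition product_cone :: "('o, 'a) cat \<Rightarrow> 'o \<Rightarrow> 'o \<Rightarrow> 'o \<times> 'a \<times> 'a" where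
  "product_cone C A B = (SOME (P, p, q). is_product C A B P p q)"

definition prod_ob :: "('o, 'a) cat \<Rightarrow> 'o \<Rightarrow> 'o \<Rightarrow> 'o" where
  "prod_ob C A B = fst (product_cone C A B)"

definition proj1 :: "('o, 'a) cat \<Rightarrow> 'o \<Rightarrow> 'o \<Rightarrow> 'a" where
  "proj1 C A B = fst (snd (product_cone C A B))"

definition proj2 :: "('o, 'a) cat \<Rightarrow> 'o \<Rightarrow> 'o \<Rightarrow> 'a" where
  "proj2 C A B = snd (snd (product_cone C A B))"

definition pair :: "('o, 'a) cat \<Rightarrow> 'a \<Rightarrow> 'a \<Rightarrow> 'a" where
  "pair C a b = (THE h. h \<in> hom C (Dom C a) (prod_ob C (Cod C a) (Cod C b)) \<and>
     proj1 C (Cod C a) (Cod C b) \<cdot>\<^bsub>C\<^esub> h = a \<and> proj2 C (Cod C a) (Cod C b) \<cdot>\<^bsub>C\<^esub> h = b)"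


section \<open>Mal'cev categories\<close>

text \<open>In the following definitions \<open>r\<close> is a monomorphism representing a relation
  \<open>R \<rightarrowtail> A \<times> A\<close>, and the two components of \<open>r\<close> are its composites with the projections.\<close>

definition reflexive_rel :: "('o, 'a) cat \<Rightarrow> 'o \<Rightarrow> 'a \<Rightarrow> bool" where
  "reflexive_rel C A r \<longleftrightarrow> (\<exists>d\<in>hom C A (Dom C r). r \<cdot>\<^bsub>C\<^esub> d = pair C (Ide C A) (Ide C A))"

definition symmetric_rel :: "('o, 'a) cat \<Rightarrow> 'o \<Rightarrow> 'a \<Rightarrow> bool" where
  "symmetric_rel C A r \<longleftrightarrow> (\<exists>s\<in>hom C (Dom C r) (Dom C r).
     r \<cdot>\<^bsub>C\<^esub> s = pair C (proj2 C A A \<cdot>\<^bsub>C\<^esub> r) (proj1 C A A \<cdot>\<^bsub>C\<^esub> r))"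

definition transitive_rel :: "('o, 'a) cat \<Rightarrow> 'o \<Rightarrow> 'a \<Rightarrow> bool" where
  "transitive_rel C A r \<longleftrightarrow>
     (\<forall>u v. is_pullback C (proj2 C A A \<cdot>\<^bsub>C\<^esub> r) (proj1 C A A \<cdot>\<^bsub>C\<^esub> r) u v \<longrightarrow>
        (\<exists>t\<in>hom C (Dom C u) (Dom C r).
           r \<cdot>\<^bsub>C\<^esub> t = pair C (proj1 C A A \<cdot>\<^bsub>C\<^esub> r \<cdot>\<^bsub>C\<^esub> u) (proj2 C A A \<cdot>\<^bsub>C\<^esub> r \<cdot>\<^bsub>C\<^esub> v)))"

definition equivalence_rel :: "('o, 'a) cat \<Rightarrow> 'o \<Rightarrow> 'a \<Rightarrow> bool" where
  "equivalence_rel C A r \<longleftrightarrow> reflexive_rel C A r \<and> symmetric_rel C A r \<and> transitive_rel C A r"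

definition malcev_category :: "('o, 'a) cat \<Rightarrow> bool" where
  "malcev_category C \<longleftrightarrow> category C \<and> has_finite_limits C \<and>
     (\<forall>A\<in>Ob C. \<forall>r. monic C r \<and> Cod C r = prod_ob C A A \<and> reflexive_rel C A r \<longrightarrow>
        equivalence_rel C A r)"


section \<open>Subobjects and images\<close>

definition factors_through :: "('o, 'a) cat \<Rightarrow> 'a \<Rightarrow> 'a \<Rightarrow> bool" where
  "factors_through C f m \<longleftrightarrow> (\<exists>h\<in>hom C (Dom C f) (Dom C m). f = m \<cdot>\<^bsub>C\<^esub> h)"

text \<open>A subobject of \<open>X\<close> is an equivalence class of monomorphisms into \<open>X\<close>.\<close>

definition sub_class :: "('o, 'a) cat \<Rightarrow> 'a \<Rightarrow> 'a set" where
  "sub_class C m = {n. monic C n \<and> Cod C n = Cod C m \<and>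
     factors_through C n m \<and> factors_through C m n}"

definition subobjects :: "('o, 'a) cat \<Rightarrow> 'o \<Rightarrow> 'a set set" where
  "subobjects C X = {sub_class C m | m. monic C m \<and> Cod C m = X}"

text \<open>Images are the monomorphic parts of (regular epi, mono) factorizations. Such a factorization
  is unique up to isomorphism; in a regular category \<open>im C f\<close> is a subobject of the
  codomain of \<open>f\<close>.\<close>

definition im :: "('o, 'a) cat \<Rightarrow> 'a \<Rightarrow> 'a set" where
  "im C f = {m. monic C m \<and> (\<exists>e. regular_epi C e \<and> Cod C e = Dom C m \<and> f = m \<cdot>\<^bsub>C\<^esub> e)}"


section \<open>The category of relations\<close>

text \<open>A relation from \<open>A\<close> to \<open>B\<close> is a triple \<open>(A, B, U)\<close> with \<open>U\<close> a subobject of \<open>A \<times> B\<close>; the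
  triple records source and target, which \<open>U\<close> alone need not determine.\<close>

type_synonym ('o, 'a) relation = "'o \<times> 'o \<times> 'a set"

definition rel_ide :: "('o, 'a) cat \<Rightarrow> 'o \<Rightarrow> ('o, 'a) relation" where
  "rel_ide C A = (A, A, sub_class C (pair C (Ide C A) (Ide C A)))"

text \<open>The composite of \<open>R : A \<rightarrow> B\<close> and \<open>S : B \<rightarrow> D\<close> is the image of \<open>R \<times>\<^sub>B S \<rightarrow> A \<times> D\<close>. The
  image does not depend on the chosen representatives and pullback, so that the union over all
  choices is again a single equivalence class.\<close>

definition rel_comp :: "('o, 'a) cat \<Rightarrow> ('o, 'a) relation \<Rightarrow> ('o, 'a) relation \<Rightarrow> ('o, 'a) relation"
  where
  "rel_comp C = (\<lambda>(B', D, V) (A, B, U). (A, D,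
     \<Union>{im C (pair C (proj1 C A B \<cdot>\<^bsub>C\<^esub> r \<cdot>\<^bsub>C\<^esub> u) (proj2 C B D \<cdot>\<^bsub>C\<^esub> s \<cdot>\<^bsub>C\<^esub> v)) | r s u v.
         r \<in> U \<and> s \<in> V \<and> is_pullback C (proj2 C A B \<cdot>\<^bsub>C\<^esub> r) (proj1 C B D \<cdot>\<^bsub>C\<^esub> s) u v}))"

definition Rel :: "('o, 'a) cat \<Rightarrow> ('o, ('o, 'a) relation) cat" where
  "Rel C = \<lparr>Ob = Ob C,
     Ar = {(A, B, U). A \<in> Ob C \<and> B \<in> Ob C \<and> U \<in> subobjects C (prod_ob C A B)},
     Dom = (\<lambda>(A, B, U). A),
     Cod = (\<lambda>(A, B, U). B),
     Ide = rel_ide C,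
     Comp = rel_comp C\<rparr>"

definition rel_dagger :: "('o, 'a) cat \<Rightarrow> ('o, 'a) relation \<Rightarrow> ('o, 'a) relation" where
  "rel_dagger C = (\<lambda>(A, B, U). (B, A,
     \<Union>{sub_class C (pair C (proj2 C A B \<cdot>\<^bsub>C\<^esub> r) (proj1 C A B \<cdot>\<^bsub>C\<^esub> r)) | r. r \<in> U}))"


section \<open>The bottleneck principle\<close>

text \<open>Of a dagger monoidal category, the principle involves only the underlying category \<open>D\<close>, the
  dagger \<open>dag\<close> and the monoidal unit \<open>I\<close>.\<close>

definition bottleneck_principle :: "('o, 'a) cat \<Rightarrow> ('a \<Rightarrow> 'a) \<Rightarrow> 'o \<Rightarrow> bool" where
  "bottleneck_principle D dag I \<longleftrightarrow>
     (\<forall>A\<in>Ob D. \<forall>B\<in>Ob D. \<forall>R\<in>hom D A B.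
        (\<exists>\<psi>\<in>hom D I A. \<exists>\<phi>\<in>hom D I A. dag R \<cdot>\<^bsub>D\<^esub> R = \<psi> \<cdot>\<^bsub>D\<^esub> dag \<phi>) \<longrightarrow>
        (\<exists>\<phi>\<in>hom D I A. \<exists>\<psi>\<in>hom D I B. R = \<psi> \<cdot>\<^bsub>D\<^esub> dag \<phi>))"

end

theory Submission
  imports Defs
begin

text \<open>
  In the internal language the argument is short. Let \<open>R : A \<rightarrow> B\<close> satisfy
  \<open>R\<^sup>\<dagger> \<circ> R = \<psi> \<circ> \<phi>\<^sup>\<dagger>\<close>. If \<open>R(a, b)\<close> and \<open>R(a', b')\<close>, then \<open>R\<^sup>\<dagger> \<circ> R\<close> contains \<open>(a, a)\<close> and
  \<open>(a', a')\<close>, so that \<open>\<phi>(a)\<close> and \<open>\<psi>(a')\<close> hold; hence \<open>R\<^sup>\<dagger> \<circ> R\<close> contains \<open>(a, a')\<close>, which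
  means that some \<open>b''\<close> has \<open>R(a, b'')\<close> and \<open>R(a', b'')\<close> (\<open>bottleneck_connects\<close>).
  Relations in a Mal'cev category are difunctional (\<open>malcev_difunctional\<close>), so the zigzag
  \<open>R(a, b'')\<close>, \<open>R(a', b'')\<close>, \<open>R(a', b')\<close> gives \<open>R(a, b')\<close> (\<open>connected_rectangle\<close>). Thus \<open>R\<close> is the
  product of its domain \<open>M \<rightarrowtail> A\<close> and its range \<open>N \<rightarrowtail> B\<close>, and these two subobjects, read as
  relations from the unit, are the required states (\<open>rectangle_im\<close>).

  The internal language is rendered by generalized elements. A relation is a span \<open>a : R \<rightarrow> A\<close>,
  \<open>b : R \<rightarrow> B\<close> with monic pairing, and an element of it is an arrow \<open>x : X \<rightarrow> R\<close>, relating
  \<open>a \<cdot> x\<close> to \<open>b \<cdot> x\<close>. Eliminating an existential quantifier replaces \<open>X\<close> by the domain of a cover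
  \<open>c : Z \<rightarrow> X\<close> (\<open>cover_lift\<close>). This is harmless because the
  conclusions are memberships in a subobject, and those descend along covers
  (\<open>cover_descend\<close>).
\<close>


section \<open>Arrows, subobjects and pullbacks\<close>

context category
begin

lemma Ide_simps [simp]:
  assumes "A \<in> Ob C"
  shows "Ide C A \<in> Ar C" "Dom C (Ide C A) = A" "Cod C (Ide C A) = A"
  using Ide_in_hom[OF assms] by (auto simp: hom_def)

lemma Dom_Ob [simp]: "f \<in> Ar C \<Longrightarrow> Dom C f \<in> Ob C"
  and Cod_Ob [simp]: "f \<in> Ar C \<Longrightarrow> Cod C f \<in> Ob C"
  by (simp_all add: Dom_in_Ob Cod_in_Ob)

lemma comp_simps [simp]:
  assumes "f \<in> Ar C" "g \<in> Ar C" "Cod C f = Dom C g"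
  shows "g \<cdot> f \<in> Ar C" "Dom C (g \<cdot> f) = Dom C f" "Cod C (g \<cdot> f) = Cod C g"
  using Comp_in_hom[of f "Dom C f" "Dom C g" g "Cod C g"] assms by (auto simp: hom_def)

lemma comp_Ide [simp]: "f \<in> Ar C \<Longrightarrow> Dom C f = A \<Longrightarrow> f \<cdot> Ide C A = f"
  using Comp_Ide[of f A "Cod C f"] by (auto simp: hom_def)

lemma Ide_comp [simp]: "f \<in> Ar C \<Longrightarrow> Cod C f = A \<Longrightarrow> Ide C A \<cdot> f = f"
  using Ide_Comp[of f "Dom C f" A] by (auto simp: hom_def)

lemma comp_assoc [simp]:
  "f \<in> Ar C \<Longrightarrow> g \<in> Ar C \<Longrightarrow> h \<in> Ar C \<Longrightarrow> Cod C f = Dom C g \<Longrightarrow> Cod C g = Dom C h \<Longrightarrow>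
    (h \<cdot> g) \<cdot> f = h \<cdot> (g \<cdot> f)"
  using Comp_assoc[of f "Dom C f" "Dom C g" g "Dom C h" h "Cod C h"] by (auto simp: hom_def)

text \<open>Composites are normalized by associating to the right, which hides the left-hand side of
  an equation \<open>g \<cdot> f = k\<close> inside \<open>g \<cdot> (f \<cdot> h)\<close>; this rule recovers it.\<close>

lemma comp_extend:
  "g \<cdot> f = k \<Longrightarrow> f \<in> Ar C \<Longrightarrow> g \<in> Ar C \<Longrightarrow> h \<in> Ar C \<Longrightarrow> Cod C h = Dom C f \<Longrightarrow>
    Cod C f = Dom C g \<Longrightarrow> g \<cdot> (f \<cdot> h) = k \<cdot> h"
  using comp_assoc[of h f g] by simp

lemma monic_cancel:
  "m \<cdot> f = m \<cdot> g \<Longrightarrow> monic C m \<Longrightarrow> f \<in> Ar C \<Longrightarrow> g \<in> Ar C \<Longrightarrow> Dom C f = Dom C g \<Longrightarrow>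
    Cod C f = Dom C m \<Longrightarrow> Cod C g = Dom C m \<Longrightarrow> f = g"
  unfolding monic_def hom_def by blast

lemma monicI:
  assumes "m \<in> Ar C"
    and "\<And>f g. f \<in> Ar C \<Longrightarrow> g \<in> Ar C \<Longrightarrow> Dom C f = Dom C g \<Longrightarrow> Cod C f = Dom C m \<Longrightarrow>
      Cod C g = Dom C m \<Longrightarrow> m \<cdot> f = m \<cdot> g \<Longrightarrow> f = g"
  shows "monic C m"
  using assms unfolding monic_def hom_def by auto

lemma monic_Ar [simp]: "monic C m \<Longrightarrow> m \<in> Ar C"
  by (simp add: monic_def)

lemma factors_iff:
  "factors_through C f m \<longleftrightarrow> (\<exists>h\<in>Ar C. Dom C h = Dom C f \<and> Cod C h = Dom C m \<and> f = m \<cdot> h)"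
  unfolding factors_through_def hom_def by auto

lemma factors_trans:
  assumes "factors_through C f g" "factors_through C g h" "h \<in> Ar C"
  shows "factors_through C f h"
proof -
  obtain a where a: "a \<in> Ar C" "Dom C a = Dom C f" "Cod C a = Dom C g" "f = g \<cdot> a"
    using assms(1) factors_iff by auto
  obtain b where b: "b \<in> Ar C" "Dom C b = Dom C g" "Cod C b = Dom C h" "g = h \<cdot> b"
    using assms(2) factors_iff by auto
  have "f = h \<cdot> (b \<cdot> a)"
    using a(1,3,4) b assms(3) comp_assoc[of a b h] by metis
  then show ?thesis
    unfolding factors_iff using a(1,2,3) b(1,2,3) by (intro bexI[of _ "b \<cdot> a"]) auto
qed

lemma factors_postcomp:
  assumes "factors_through C f m" "m \<in> Ar C" "g \<in> Ar C" "Cod C m = Dom C g"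
  shows "factors_through C (g \<cdot> f) (g \<cdot> m)"
proof -
  obtain h where "h \<in> Ar C" "Dom C h = Dom C f" "Cod C h = Dom C m" "f = m \<cdot> h"
    using assms(1) factors_iff by auto
  then show ?thesis
    unfolding factors_iff using assms by (intro bexI[of _ h]) auto
qed

lemma factors_refl: "m \<in> Ar C \<Longrightarrow> factors_through C m m"
  unfolding factors_iff by (intro bexI[of _ "Ide C (Dom C m)"]) auto

lemma sub_class_self: "monic C m \<Longrightarrow> m \<in> sub_class C m"
  by (simp add: sub_class_def factors_refl)

lemma sub_classD:
  assumes "n \<in> sub_class C m"
  shows "monic C n" "Cod C n = Cod C m" "factors_through C n m" "factors_through C m n"
  using assms by (auto simp: sub_class_def)

lemma pullbackD:
  assumes "is_pullback C f g u v"
  shows "f \<in> Ar C" "g \<in> Ar C" "Cod C f = Cod C g" "u \<in> Ar C" "v \<in> Ar C" "Dom C v = Dom C u"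
    "Cod C u = Dom C f" "Cod C v = Dom C g" "f \<cdot> u = g \<cdot> v"
  using assms by (auto simp: is_pullback_def)

lemma pullback_lift:
  assumes "is_pullback C f g u v" "a \<in> Ar C" "b \<in> Ar C" "Dom C a = Dom C b"
    "Cod C a = Dom C f" "Cod C b = Dom C g" "f \<cdot> a = g \<cdot> b"
  obtains h where "h \<in> Ar C" "Dom C h = Dom C a" "Cod C h = Dom C u" "u \<cdot> h = a" "v \<cdot> h = b"
proof -
  have "a \<in> hom C (Dom C a) (Dom C f)" "b \<in> hom C (Dom C a) (Dom C g)"
    using assms by (auto simp: hom_def)
  then have "\<exists>!h. h \<in> hom C (Dom C a) (Dom C u) \<and> u \<cdot> h = a \<and> v \<cdot> h = b"
    using assms unfolding is_pullback_def by blast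
  then show ?thesis
    using that by (auto simp: hom_def)
qed

lemma pullback_ext:
  assumes "is_pullback C f g u v" "h \<in> Ar C" "k \<in> Ar C" "Dom C h = Dom C k"
    "Cod C h = Dom C u" "Cod C k = Dom C u" "u \<cdot> h = u \<cdot> k" "v \<cdot> h = v \<cdot> k"
  shows "h = k"
proof -
  note pb = pullbackD[OF assms(1)]
  have "f \<cdot> (u \<cdot> h) = g \<cdot> (v \<cdot> h)"
    using comp_extend[OF pb(9), of h] pb assms by simp
  moreover have "u \<cdot> h \<in> hom C (Dom C h) (Dom C f)" "v \<cdot> h \<in> hom C (Dom C h) (Dom C g)"
    using pb assms by (auto simp: hom_def)
  ultimately have "\<exists>!l. l \<in> hom C (Dom C h) (Dom C u) \<and> u \<cdot> l = u \<cdot> h \<and> v \<cdot> l = v \<cdot> h"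
    using assms(1) unfolding is_pullback_def by blast
  moreover have "h \<in> hom C (Dom C h) (Dom C u)" "k \<in> hom C (Dom C h) (Dom C u)"
    using assms by (auto simp: hom_def)
  ultimately show ?thesis
    using assms(7,8) by metis
qed

lemma pullback_monic:
  assumes "is_pullback C f m u v" "monic C m"
  shows "monic C u"
proof (rule monicI)
  note pb = pullbackD[OF assms(1)]
  show "u \<in> Ar C" using pb by simp
  fix h k
  assume hk: "h \<in> Ar C" "k \<in> Ar C" "Dom C h = Dom C k" "Cod C h = Dom C u" "Cod C k = Dom C u"
    "u \<cdot> h = u \<cdot> k"
  have "m \<cdot> (v \<cdot> h) = m \<cdot> (v \<cdot> k)"
    using comp_extend[OF pb(9), of h] comp_extend[OF pb(9), of k] hk pb by simp
  then have "v \<cdot> h = v \<cdot> k"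
    by (rule monic_cancel[OF _ assms(2)]) (use hk pb in auto)
  then show "h = k"
    using pullback_ext[OF assms(1)] hk by blast
qed


section \<open>Covers, regular epimorphisms and images\<close>

text \<open>This is orthogonality to monomorphisms, the property of strong epimorphisms, phrased as
  descent of membership in a subobject. Closure under composition is immediate for this notion,
  while composites of regular epimorphisms are not evidently regular.\<close>

definition cover :: "'a \<Rightarrow> bool" where
  "cover c \<longleftrightarrow> c \<in> Ar C \<and>
    (\<forall>m f. monic C m \<and> f \<in> Ar C \<and> Dom C f = Cod C c \<and> Cod C f = Cod C m \<and>
      factors_through C (f \<cdot> c) m \<longrightarrow> factors_through C f m)"

lemma cover_Ar [simp]: "cover c \<Longrightarrow> c \<in> Ar C"
  by (simp add: cover_def)

lemma cover_descend:
  "factors_through C (f \<cdot> c) m \<Longrightarrow> cover c \<Longrightarrow> monic C m \<Longrightarrow> f \<in> Ar C \<Longrightarrow>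
    Dom C f = Cod C c \<Longrightarrow> Cod C f = Cod C m \<Longrightarrow> factors_through C f m"
  unfolding cover_def by blast

lemma cover_comp:
  assumes "cover c" "cover d" "Cod C d = Dom C c"
  shows "cover (c \<cdot> d)"
  unfolding cover_def
proof (intro conjI allI impI)
  show "c \<cdot> d \<in> Ar C" using assms by simp
  fix m f
  assume *: "monic C m \<and> f \<in> Ar C \<and> Dom C f = Cod C (c \<cdot> d) \<and> Cod C f = Cod C m \<and>
    factors_through C (f \<cdot> (c \<cdot> d)) m"
  then have "factors_through C ((f \<cdot> c) \<cdot> d) m"
    using assms by simp
  then have "factors_through C (f \<cdot> c) m"
    by (rule cover_descend[OF _ assms(2)]) (use * assms in auto)
  then show "factors_through C f m"
    by (rule cover_descend[OF _ assms(1)]) (use * assms in auto)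
qed

lemma coequalizerD:
  assumes "is_coequalizer C f g e"
  shows "f \<in> Ar C" "g \<in> Ar C" "Dom C f = Dom C g" "Cod C f = Cod C g" "e \<in> Ar C"
    "Dom C e = Cod C g" "e \<cdot> f = e \<cdot> g"
  using assms by (auto simp: is_coequalizer_def)

lemma coequalizer_desc:
  assumes "is_coequalizer C f g e" "h \<in> Ar C" "Dom C h = Cod C g" "h \<cdot> f = h \<cdot> g"
  obtains k where "k \<in> Ar C" "Dom C k = Cod C e" "Cod C k = Cod C h" "k \<cdot> e = h"
proof -
  have "\<exists>!k. k \<in> hom C (Cod C e) (Cod C h) \<and> k \<cdot> e = h"
    using assms unfolding is_coequalizer_def by metis
  then show ?thesis
    using that by (auto simp: hom_def)
qed

lemma coequalizer_epi:
  assumes "h \<cdot> e = k \<cdot> e" "is_coequalizer C f g e" "h \<in> Ar C" "k \<in> Ar C"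
    "Dom C h = Cod C e" "Dom C k = Cod C e" "Cod C h = Cod C k"
  shows "h = k"
proof -
  note ce = coequalizerD[OF assms(2)]
  have "h \<cdot> e \<in> Ar C" "Dom C (h \<cdot> e) = Cod C f" "Cod C (h \<cdot> e) = Cod C h"
    using ce assms by simp_all
  moreover have "(h \<cdot> e) \<cdot> f = (h \<cdot> e) \<cdot> g"
    using ce assms by simp
  ultimately have "\<exists>!l. l \<in> hom C (Cod C e) (Cod C h) \<and> l \<cdot> e = h \<cdot> e"
    using assms(2) unfolding is_coequalizer_def by metis
  moreover have "h \<in> hom C (Cod C e) (Cod C h)" "k \<in> hom C (Cod C e) (Cod C h)"
    using assms by (auto simp: hom_def)
  ultimately show ?thesis
    using assms(1) by metis
qed

lemma regular_epi_Ar [simp]: "regular_epi C e \<Longrightarrow> e \<in> Ar C"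
  unfolding regular_epi_def is_coequalizer_def by blast

lemma regular_epi_cancel:
  "h \<cdot> e = k \<cdot> e \<Longrightarrow> regular_epi C e \<Longrightarrow> h \<in> Ar C \<Longrightarrow> k \<in> Ar C \<Longrightarrow> Dom C h = Cod C e \<Longrightarrow>
    Dom C k = Cod C e \<Longrightarrow> Cod C h = Cod C k \<Longrightarrow> h = k"
  unfolding regular_epi_def using coequalizer_epi by blast

text \<open>If \<open>f \<cdot> e = m \<cdot> h\<close> with \<open>m\<close> monic, then \<open>h\<close> coequalizes every pair that \<open>e\<close> coequalizes,
  so it factors through \<open>e\<close>, and the factorization is the diagonal filler.\<close>

lemma regular_epi_cover:
  assumes "regular_epi C e"
  shows "cover e"
  unfolding cover_def
proof (intro conjI allI impI)
  show "e \<in> Ar C" using assms by simp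
  obtain p q where ce: "is_coequalizer C p q e"
    using assms unfolding regular_epi_def by blast
  note ceD = coequalizerD[OF ce]
  fix m f
  assume *: "monic C m \<and> f \<in> Ar C \<and> Dom C f = Cod C e \<and> Cod C f = Cod C m \<and>
    factors_through C (f \<cdot> e) m"
  then obtain h where h: "h \<in> Ar C" "Dom C h = Dom C e" "Cod C h = Dom C m" "f \<cdot> e = m \<cdot> h"
    unfolding factors_iff using assms comp_simps(2)[of e f] regular_epi_Ar[OF assms] by metis
  have m: "m \<in> Ar C" using * by simp
  have "m \<cdot> (h \<cdot> p) = m \<cdot> (h \<cdot> q)"
    using comp_extend[OF h(4)[symmetric], of p] comp_extend[OF h(4)[symmetric], of q] h(1-3) m * ceD
    by simp
  then have "h \<cdot> p = h \<cdot> q"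
    by (rule monic_cancel) (use * h ceD in auto)
  then obtain k where k: "k \<in> Ar C" "Dom C k = Cod C e" "Cod C k = Cod C h" "k \<cdot> e = h"
    using coequalizer_desc[OF ce, of h] h ceD by metis
  have "(m \<cdot> k) \<cdot> e = f \<cdot> e"
    using k h m assms by simp
  then have "m \<cdot> k = f"
    by (rule coequalizer_epi[OF _ ce]) (use k h m * in auto)
  then show "factors_through C f m"
    unfolding factors_iff using k h * by (intro bexI[of _ k]) auto
qed

text \<open>A retraction \<open>h\<close> with section \<open>k\<close> is the coequalizer of the idempotent \<open>k \<cdot> h\<close> and the
  identity.\<close>

lemma split_epi_regular:
  assumes "h \<in> Ar C" "k \<in> Ar C" "Dom C h = Cod C k" "Cod C h = Dom C k"
    "h \<cdot> k = Ide C (Dom C k)"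
  shows "regular_epi C h"
  unfolding regular_epi_def
proof (intro exI)
  show "is_coequalizer C (k \<cdot> h) (Ide C (Dom C h)) h"
    unfolding is_coequalizer_def
  proof (intro conjI ballI impI)
    show "h \<cdot> (k \<cdot> h) = h \<cdot> Ide C (Dom C h)"
      using comp_extend[OF assms(5), of h] assms by simp
    fix f
    assume f: "f \<in> Ar C" and **: "Dom C f = Cod C (k \<cdot> h) \<and> f \<cdot> (k \<cdot> h) = f \<cdot> Ide C (Dom C h)"
    have *: "Dom C f = Dom C h" "f \<cdot> (k \<cdot> h) = f"
      using f ** assms by auto
    show "\<exists>!l. l \<in> hom C (Cod C h) (Cod C f) \<and> l \<cdot> h = f"
    proof (rule ex1I[of _ "f \<cdot> k"])
      show "f \<cdot> k \<in> hom C (Cod C h) (Cod C f) \<and> (f \<cdot> k) \<cdot> h = f"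
        using f * assms by (simp add: hom_def)
      fix l assume "l \<in> hom C (Cod C h) (Cod C f) \<and> l \<cdot> h = f"
      then show "l = f \<cdot> k"
        using assms by (auto simp: hom_def)
    qed
  qed (use assms in auto)
qed

text \<open>Two (regular epi, mono) factorizations of an arrow have mutually factoring monic parts by
  orthogonality. Conversely, a monomorphism equivalent to \<open>m\<close> differs from it by an
  isomorphism, which can be absorbed into the regular epimorphism.\<close>

lemma im_eq_sub_class:
  assumes "monic C m" "regular_epi C e" "Cod C e = Dom C m"
  shows "im C (m \<cdot> e) = sub_class C m"
proof (intro set_eqI iffI)
  fix n assume "n \<in> im C (m \<cdot> e)"
  then obtain d where n: "monic C n" "regular_epi C d" "Cod C d = Dom C n" "m \<cdot> e = n \<cdot> d"
    unfolding im_def by blast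
  have dom: "Dom C e = Dom C d" and cod: "Cod C n = Cod C m"
    using arg_cong[OF n(4), of "Dom C"] arg_cong[OF n(4), of "Cod C"] n(1-3) assms by auto
  have "factors_through C m n"
    unfolding n(4)
    by (rule cover_descend[OF _ regular_epi_cover[OF assms(2)]]) (use n assms cod dom in \<open>auto simp: factors_iff intro!: bexI[of _ d]\<close>)
  moreover have "factors_through C n m"
    by (rule cover_descend[OF _ regular_epi_cover[OF n(2)]]) (use n(1-3) n(4)[symmetric] assms cod dom in \<open>auto simp: factors_iff intro!: bexI[of _ e]\<close>)
  ultimately show "n \<in> sub_class C m"
    using n cod by (simp add: sub_class_def)
next
  fix n assume "n \<in> sub_class C m"
  note n = sub_classD[OF this]
  obtain h where h: "h \<in> Ar C" "Dom C h = Dom C n" "Cod C h = Dom C m" "n = m \<cdot> h"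
    using n(3) unfolding factors_iff by blast
  obtain k where k: "k \<in> Ar C" "Dom C k = Dom C m" "Cod C k = Dom C n" "m = n \<cdot> k"
    using n(4) unfolding factors_iff by blast
  have "n \<cdot> (k \<cdot> h) = n \<cdot> Ide C (Dom C n)"
    using comp_extend[OF k(4)[symmetric], of h] h(1-3) h(4)[symmetric] n(1) k(1-3) by simp
  then have kh: "k \<cdot> h = Ide C (Dom C n)"
    by (rule monic_cancel) (use h(1-3) k(1-3) n(1) in auto)
  have ke: "m \<cdot> e = n \<cdot> (k \<cdot> e)"
    using comp_extend[OF k(4)[symmetric], of e] k(1-3) n(1) assms by simp
  obtain p q where pq: "is_coequalizer C p q e"
    using assms(2) unfolding regular_epi_def by blast
  note ce = coequalizerD[OF pq]
  have hk: "h \<cdot> k = Ide C (Dom C m)"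
  proof (rule monic_cancel[OF _ assms(1)])
    show "m \<cdot> (h \<cdot> k) = m \<cdot> Ide C (Dom C m)"
      using comp_extend[OF h(4)[symmetric], of k] h(1-3) k(1-3) k(4)[symmetric] assms by simp
  qed (use h(1-3) k(1-3) assms in auto)
  have "is_coequalizer C p q (k \<cdot> e)"
    unfolding is_coequalizer_def
  proof (intro conjI ballI impI)
    fix f assume f: "f \<in> Ar C" "Dom C f = Cod C p \<and> f \<cdot> p = f \<cdot> q"
    then obtain l where l: "l \<in> Ar C" "Dom C l = Cod C e" "Cod C l = Cod C f" "l \<cdot> e = f"
      using coequalizer_desc[OF pq, of f] ce by metis
    show "\<exists>!l. l \<in> hom C (Cod C (k \<cdot> e)) (Cod C f) \<and> l \<cdot> (k \<cdot> e) = f"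
    proof (rule ex1I[of _ "l \<cdot> h"])
      have "h \<cdot> (k \<cdot> e) = e"
        using comp_extend[OF hk, of e] assms h(1-3) k(1-3) by simp
      then show "l \<cdot> h \<in> hom C (Cod C (k \<cdot> e)) (Cod C f) \<and> (l \<cdot> h) \<cdot> (k \<cdot> e) = f"
        using l h(1-3) k(1-3) assms by (simp add: hom_def)
      fix l' assume "l' \<in> hom C (Cod C (k \<cdot> e)) (Cod C f) \<and> l' \<cdot> (k \<cdot> e) = f"
      then have l': "l' \<in> Ar C" "Dom C l' = Dom C n" "Cod C l' = Cod C f" "l' \<cdot> (k \<cdot> e) = f"
        using k(1-3) assms by (auto simp: hom_def)
      have "l' \<cdot> k = l"
        by (rule coequalizer_epi[OF _ pq]) (use l l' k(1-3) assms in auto)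
      then have "l \<cdot> h = l' \<cdot> (k \<cdot> h)"
        using l' k(1-3) h(1-3) by auto
      then show "l' = l \<cdot> h"
        using l' kh by simp
    qed
  qed (use ce k(1-3) assms comp_extend[OF ce(7)] in auto)
  then have "regular_epi C (k \<cdot> e)"
    unfolding regular_epi_def by blast
  then show "n \<in> im C (m \<cdot> e)"
    unfolding im_def using n ke k(1-3) assms by auto
qed

end


section \<open>Terminal object, products and pullbacks from finite limits\<close>

locale finitely_complete_category = category +
  assumes finite_limits: "has_finite_limits C"
begin

lemma terminal_one: "is_terminal C (one C)"
proof -
  define J :: "(nat, nat) cat" where
    "J = \<lparr>Ob = {}, Ar = {}, Dom = id, Cod = id, Ide = id, Comp = (\<lambda>g f. f)\<rparr>"
  have "category J"
    by unfold_locales (auto simp: J_def hom_def)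
  then have "is_functor J C (\<lambda>_. undefined) (\<lambda>_. undefined)"
    using category_axioms by (simp add: is_functor_def J_def)
  then obtain X l where "is_limit J C (\<lambda>_. undefined) (\<lambda>_. undefined) X l"
    using finite_limits unfolding has_finite_limits_def by (force simp: J_def)
  then have "is_terminal C X"
    unfolding is_limit_def is_cone_def is_terminal_def by (simp add: J_def)
  then show ?thesis
    unfolding one_def by (rule someI)
qed

lemma product_exists:
  assumes "A \<in> Ob C" "B \<in> Ob C"
  shows "\<exists>P p q. is_product C A B P p q"
proof -
  define J :: "(nat, nat) cat" where
    "J = \<lparr>Ob = {0, 1}, Ar = {0, 1}, Dom = id, Cod = id, Ide = id, Comp = (\<lambda>g f. f)\<rparr>"
  define Fo where "Fo = (\<lambda>j::nat. if j = 0 then A else B)"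
  define Fa where "Fa = (\<lambda>j::nat. Ide C (Fo j))"
  have "category J"
    by unfold_locales (auto simp: J_def hom_def)
  then have F: "is_functor J C Fo Fa"
    using category_axioms assms by (auto simp: is_functor_def J_def Fo_def Fa_def hom_def)
  then obtain X l where X: "is_limit J C Fo Fa X l"
    using finite_limits unfolding has_finite_limits_def by (force simp: J_def)
  have cone: "is_cone J C Fo Fa Y k \<longleftrightarrow> Y \<in> Ob C \<and> k 0 \<in> hom C Y A \<and> k 1 \<in> hom C Y B" for Y k
    unfolding is_cone_def using assms by (auto simp: J_def Fo_def Fa_def hom_def)
  have "is_product C A B X (l 0) (l 1)"
    unfolding is_product_def
  proof (intro conjI allI ballI)
    fix Y a b assume ab: "a \<in> hom C Y A" "b \<in> hom C Y B"
    define k where "k = (\<lambda>j::nat. if j = 0 then a else b)"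
    have "is_cone J C Fo Fa Y k"
      using ab by (auto simp: cone k_def hom_def)
    then have "\<exists>!h. h \<in> hom C Y X \<and> (\<forall>j\<in>Ob J. l j \<cdot> h = k j)"
      using X unfolding is_limit_def by blast
    then show "\<exists>!h. h \<in> hom C Y X \<and> l 0 \<cdot> h = a \<and> l 1 \<cdot> h = b"
      by (simp add: J_def k_def)
  qed (use X cone in \<open>auto simp: is_limit_def\<close>)
  then show ?thesis by blast
qed

lemma product_prod_ob:
  assumes "A \<in> Ob C" "B \<in> Ob C"
  shows "is_product C A B (prod_ob C A B) (proj1 C A B) (proj2 C A B)"
proof -
  have "\<exists>x. case x of (P, p, q) \<Rightarrow> is_product C A B P p q"
    using product_exists[OF assms] by auto
  then have "case product_cone C A B of (P, p, q) \<Rightarrow> is_product C A B P p q"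
    unfolding product_cone_def by (rule someI_ex)
  then show ?thesis
    by (simp add: prod_ob_def proj1_def proj2_def split: prod.splits)
qed

lemma pullback_exists:
  assumes f: "f \<in> Ar C" and g: "g \<in> Ar C" and "Cod C f = Cod C g"
  obtains u v where "is_pullback C f g u v"
proof -
  define J :: "(nat, nat) cat" where
    "J = \<lparr>Ob = {0, 1, 2}, Ar = {0, 1, 2, 3, 4}, Dom = (\<lambda>u. if u = 3 then 0 else if u = 4 then 1 else u),
      Cod = (\<lambda>u. if u = 3 \<or> u = 4 then 2 else u), Ide = id,
      Comp = (\<lambda>v u. if u \<in> {0, 1, 2} then v else u)\<rparr>"
  define Fo where "Fo = (\<lambda>j::nat. if j = 0 then Dom C f else if j = 1 then Dom C g else Cod C g)"
  define Fa where "Fa = (\<lambda>j::nat. if j = 3 then f else if j = 4 then g else Ide C (Fo j))"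
  have "category J"
    by unfold_locales (auto simp: J_def hom_def split: if_splits)
  then have F: "is_functor J C Fo Fa"
    using category_axioms assms by (auto simp: is_functor_def J_def Fo_def Fa_def hom_def)
  then obtain X l where X: "is_limit J C Fo Fa X l"
    using finite_limits unfolding has_finite_limits_def by (force simp: J_def)
  have cone: "is_cone J C Fo Fa Y k \<longleftrightarrow> Y \<in> Ob C \<and> k 0 \<in> hom C Y (Dom C f) \<and>
      k 1 \<in> hom C Y (Dom C g) \<and> k 2 = f \<cdot> k 0 \<and> k 2 = g \<cdot> k 1" for Y k
    unfolding is_cone_def using assms by (auto simp: J_def Fo_def Fa_def hom_def)
  have lim: "X \<in> Ob C" "l 0 \<in> hom C X (Dom C f)" "l 1 \<in> hom C X (Dom C g)" "f \<cdot> l 0 = g \<cdot> l 1"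
    "l 2 = f \<cdot> l 0"
    using X cone[of X l] by (auto simp: is_limit_def)
  have "is_pullback C f g (l 0) (l 1)"
    unfolding is_pullback_def
  proof (intro conjI allI ballI impI)
    fix Y a b assume ab: "a \<in> hom C Y (Dom C f)" "b \<in> hom C Y (Dom C g)" "f \<cdot> a = g \<cdot> b"
    define k where "k = (\<lambda>j::nat. if j = 0 then a else if j = 1 then b else f \<cdot> a)"
    have "is_cone J C Fo Fa Y k"
      using ab by (auto simp: cone k_def hom_def)
    then have ex: "\<exists>!h. h \<in> hom C Y X \<and> (\<forall>j\<in>Ob J. l j \<cdot> h = k j)"
      using X unfolding is_limit_def by blast
    have "l 2 \<cdot> h = f \<cdot> a" if "h \<in> hom C Y X" "l 0 \<cdot> h = a" for h
      using lim(2,5) that f by (auto simp: hom_def)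
    then have "h \<in> hom C Y X \<and> (\<forall>j\<in>Ob J. l j \<cdot> h = k j) \<longleftrightarrow>
        h \<in> hom C Y X \<and> l 0 \<cdot> h = a \<and> l 1 \<cdot> h = b" for h
      by (auto simp: J_def k_def)
    moreover have "Dom C (l 0) = X"
      using lim by (simp add: hom_def)
    ultimately show "\<exists>!h. h \<in> hom C Y (Dom C (l 0)) \<and> l 0 \<cdot> h = a \<and> l 1 \<cdot> h = b"
      using ex by simp
  qed (use assms lim in \<open>auto simp: hom_def\<close>)
  then show ?thesis by (rule that)
qed

lemma one_Ob [simp]: "one C \<in> Ob C"
  using terminal_one by (simp add: is_terminal_def)

lemma to_one_exists:
  assumes "X \<in> Ob C"
  obtains t where "t \<in> Ar C" "Dom C t = X" "Cod C t = one C"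
  using terminal_one assms unfolding is_terminal_def hom_def by blast

lemma to_one_unique:
  "s \<in> Ar C \<Longrightarrow> t \<in> Ar C \<Longrightarrow> Dom C s = Dom C t \<Longrightarrow> Cod C s = one C \<Longrightarrow> Cod C t = one C \<Longrightarrow> s = t"
  using terminal_one Dom_Ob[of t] unfolding is_terminal_def hom_def by blast

lemma proj_simps [simp]:
  assumes "A \<in> Ob C" "B \<in> Ob C"
  shows "prod_ob C A B \<in> Ob C" "proj1 C A B \<in> Ar C" "proj2 C A B \<in> Ar C"
    "Dom C (proj1 C A B) = prod_ob C A B" "Dom C (proj2 C A B) = prod_ob C A B"
    "Cod C (proj1 C A B) = A" "Cod C (proj2 C A B) = B"
  using product_prod_ob[OF assms] by (auto simp: is_product_def hom_def)

lemma pair_spec: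
  assumes "a \<in> Ar C" "b \<in> Ar C" "Dom C b = Dom C a"
  shows "pair C a b \<in> hom C (Dom C a) (prod_ob C (Cod C a) (Cod C b)) \<and>
    proj1 C (Cod C a) (Cod C b) \<cdot> pair C a b = a \<and> proj2 C (Cod C a) (Cod C b) \<cdot> pair C a b = b"
proof -
  have "a \<in> hom C (Dom C a) (Cod C a)" "b \<in> hom C (Dom C a) (Cod C b)"
    using assms by (auto simp: hom_def)
  then have "\<exists>!h. h \<in> hom C (Dom C a) (prod_ob C (Cod C a) (Cod C b)) \<and>
      proj1 C (Cod C a) (Cod C b) \<cdot> h = a \<and> proj2 C (Cod C a) (Cod C b) \<cdot> h = b"
    using product_prod_ob[of "Cod C a" "Cod C b"] assms unfolding is_product_def by auto
  then show ?thesis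
    unfolding pair_def by (rule theI')
qed

lemma pair_simps [simp]:
  assumes "a \<in> Ar C" "b \<in> Ar C" "Dom C a = Dom C b"
  shows "pair C a b \<in> Ar C" "Dom C (pair C a b) = Dom C b"
    "Cod C (pair C a b) = prod_ob C (Cod C a) (Cod C b)"
    "Cod C a = A \<Longrightarrow> Cod C b = B \<Longrightarrow> proj1 C A B \<cdot> pair C a b = a"
    "Cod C a = A \<Longrightarrow> Cod C b = B \<Longrightarrow> proj2 C A B \<cdot> pair C a b = b"
  using pair_spec[of a b] assms by (auto simp: hom_def)

lemma proj_pair_comp [simp]:
  assumes "a \<in> Ar C" "b \<in> Ar C" "Dom C a = Dom C b" "Cod C a = A" "Cod C b = B"
    "h \<in> Ar C" "Cod C h = Dom C b"
  shows "proj1 C A B \<cdot> (pair C a b \<cdot> h) = a \<cdot> h" "proj2 C A B \<cdot> (pair C a b \<cdot> h) = b \<cdot> h"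
proof -
  have "A \<in> Ob C" "B \<in> Ob C" using assms by auto
  then show "proj1 C A B \<cdot> (pair C a b \<cdot> h) = a \<cdot> h" "proj2 C A B \<cdot> (pair C a b \<cdot> h) = b \<cdot> h"
    using assms by (auto intro!: comp_extend)
qed

lemma prod_ext:
  assumes "A \<in> Ob C" "B \<in> Ob C" "f \<in> Ar C" "g \<in> Ar C" "Dom C f = Dom C g"
    "Cod C f = prod_ob C A B" "Cod C g = prod_ob C A B"
    "proj1 C A B \<cdot> f = proj1 C A B \<cdot> g" "proj2 C A B \<cdot> f = proj2 C A B \<cdot> g"
  shows "f = g"
proof -
  have "proj1 C A B \<cdot> f \<in> hom C (Dom C f) A" "proj2 C A B \<cdot> f \<in> hom C (Dom C f) B"
    "f \<in> hom C (Dom C f) (prod_ob C A B)" "g \<in> hom C (Dom C f) (prod_ob C A B)"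
    using assms(1-7) by (auto simp: hom_def)
  then show ?thesis
    using product_prod_ob[OF assms(1,2)] assms(8,9) unfolding is_product_def by metis
qed

lemma pair_comp:
  assumes "a \<in> Ar C" "b \<in> Ar C" "Dom C a = Dom C b" "h \<in> Ar C" "Cod C h = Dom C b"
  shows "pair C a b \<cdot> h = pair C (a \<cdot> h) (b \<cdot> h)"
  by (rule prod_ext[of "Cod C a" "Cod C b"]) (use assms in auto)

lemma pair_proj:
  assumes "A \<in> Ob C" "B \<in> Ob C" "f \<in> Ar C" "Cod C f = prod_ob C A B"
  shows "pair C (proj1 C A B \<cdot> f) (proj2 C A B \<cdot> f) = f"
  by (rule prod_ext[of A B]) (use assms in auto)

end

section \<open>Image factorization in a regular category\<close>

locale regular_cat = finitely_complete_category +
  assumes kernel_pair_coequalizer: "is_kernel_pair C f u v \<Longrightarrow> \<exists>e. is_coequalizer C u v e"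
    and regular_epi_stable: "regular_epi C f \<Longrightarrow> is_pullback C f g u v \<Longrightarrow> regular_epi C v"
begin

text \<open>Every generalized element of the codomain of a regular epimorphism \<open>e\<close> has a preimage after
  passing to a cover, the pullback of \<open>e\<close>. This is how an existential quantifier of regular
  logic is eliminated.\<close>

lemma cover_lift:
  assumes "regular_epi C e" "x \<in> Ar C" "Cod C x = Cod C e"
  obtains c y where "regular_epi C c" "Cod C c = Dom C x" "y \<in> Ar C" "Dom C y = Dom C c"
    "Cod C y = Dom C e" "e \<cdot> y = x \<cdot> c"
proof -
  obtain u v where pb: "is_pullback C e x u v"
    using pullback_exists[of e x] assms by (metis regular_epi_Ar)
  note pbD = pullbackD[OF pb]
  show ?thesis
    using that[of v u] pbD regular_epi_stable[OF assms(1) pb] by simp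
qed

text \<open>The regular epimorphism \<open>e\<close> is the coequalizer of the kernel pair of \<open>f\<close>, and \<open>m\<close> is the
  induced arrow. To see that \<open>m\<close> is monic, elements \<open>p\<close> and \<open>q\<close> with \<open>m \<cdot> p = m \<cdot> q\<close> are lifted
  along \<open>e\<close> over a cover; the lifts are identified by \<open>f\<close>, so they lie in its kernel pair, and
  therefore \<open>e\<close> identifies them.\<close>

lemma image_factorization:
  assumes f: "f \<in> Ar C"
  obtains m e where "monic C m" "regular_epi C e" "Cod C e = Dom C m" "f = m \<cdot> e"
proof -
  obtain u v where pb: "is_pullback C f f u v"
    using pullback_exists[OF f f] by blast
  note pbD = pullbackD[OF pb]
  obtain e where ce: "is_coequalizer C u v e"
    using kernel_pair_coequalizer[of f u v] pb unfolding is_kernel_pair_def by blast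
  note ceD = coequalizerD[OF ce]
  have e: "regular_epi C e"
    using ce unfolding regular_epi_def by blast
  obtain m where m: "m \<in> Ar C" "Dom C m = Cod C e" "Cod C m = Cod C f" "m \<cdot> e = f"
    using coequalizer_desc[OF ce f] pbD by metis
  have "monic C m"
  proof (rule monicI[OF m(1)])
    fix p q
    assume p: "p \<in> Ar C" "Cod C p = Dom C m" and q: "q \<in> Ar C" "Cod C q = Dom C m"
      and pq: "Dom C p = Dom C q" "m \<cdot> p = m \<cdot> q"
    obtain c x where c: "regular_epi C c" "Cod C c = Dom C p" "x \<in> Ar C" "Dom C x = Dom C c"
        "Cod C x = Dom C e" "e \<cdot> x = p \<cdot> c"
      using cover_lift[OF e, of p] p m(2) by metis
    obtain d y where d: "regular_epi C d" "Cod C d = Dom C c" "y \<in> Ar C" "Dom C y = Dom C d"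
        "Cod C y = Dom C e" "e \<cdot> y = (q \<cdot> c) \<cdot> d"
      using cover_lift[OF e, of "q \<cdot> c"] q m(2) c pq
      by (metis comp_simps regular_epi_Ar)
    note cd = regular_epi_Ar[OF c(1)] regular_epi_Ar[OF d(1)] regular_epi_Ar[OF e]
    have ex: "e \<cdot> (x \<cdot> d) = p \<cdot> (c \<cdot> d)"
      using comp_extend[OF c(6), of d] c(2-5) d(2) cd p pq by simp
    have ey: "e \<cdot> y = q \<cdot> (c \<cdot> d)"
      using d(6) c(2) d(2) cd q pq by simp
    have "f \<cdot> (x \<cdot> d) = m \<cdot> (p \<cdot> (c \<cdot> d))"
      using m(1-3) ex c(2-5) d(2) cd p unfolding m(4)[symmetric] by simp
    also have "\<dots> = m \<cdot> (q \<cdot> (c \<cdot> d))"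
      using comp_extend[OF pq(2), of "c \<cdot> d"] m(1) p q c(2) d(2) cd pq(1) by simp
    also have "\<dots> = f \<cdot> y"
      using m(1-3) ey d(2-5) cd unfolding m(4)[symmetric] by simp
    finally have fxy: "f \<cdot> (x \<cdot> d) = f \<cdot> y" .
    have edf: "Dom C e = Dom C f"
      using ceD pbD by simp
    obtain h where h: "h \<in> Ar C" "Dom C h = Dom C y" "Cod C h = Dom C u"
        "u \<cdot> h = x \<cdot> d" "v \<cdot> h = y"
      using pullback_lift[OF pb, of "x \<cdot> d" y] fxy c d cd edf by (metis comp_simps)
    have "e \<cdot> (u \<cdot> h) = e \<cdot> (v \<cdot> h)"
      using comp_extend[OF ceD(7), of h] h(1-3) ceD(5,6) pbD(1,4-8) by simp
    then have "(p \<cdot> c) \<cdot> d = (q \<cdot> c) \<cdot> d"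
      using h(4,5) ex ey c(2) d(2) cd p q pq(1) by simp
    then have "p \<cdot> c = q \<cdot> c"
      by (rule regular_epi_cancel[OF _ d(1)]) (use c(2) d(2) cd p q pq(1) in auto)
    then show "p = q"
      by (rule regular_epi_cancel[OF _ c(1)]) (use c(2) p q pq(1) in auto)
  qed
  then show ?thesis
    using that[of m e] e m by simp
qed

end


section \<open>Difunctionality of relations in a Mal'cev category\<close>

context finitely_complete_category
begin

lemma monic_pair:
  assumes "a \<in> Ar C" "b \<in> Ar C" "Dom C a = Dom C b" "monic C a \<or> monic C b"
  shows "monic C (pair C a b)"
proof (rule monicI)
  show "pair C a b \<in> Ar C" using assms by simp
  fix f g
  assume fg: "f \<in> Ar C" "g \<in> Ar C" "Dom C f = Dom C g" "Cod C f = Dom C (pair C a b)"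
    "Cod C g = Dom C (pair C a b)" "pair C a b \<cdot> f = pair C a b \<cdot> g"
  then have fg': "Cod C f = Dom C b" "Cod C g = Dom C b"
    using assms by simp_all
  have "a \<cdot> f = a \<cdot> g"
    using arg_cong[OF fg(6), of "\<lambda>h. proj1 C (Cod C a) (Cod C b) \<cdot> h"] fg(1-3) fg' assms(1-3) by simp
  moreover have "b \<cdot> f = b \<cdot> g"
    using arg_cong[OF fg(6), of "\<lambda>h. proj2 C (Cod C a) (Cod C b) \<cdot> h"] fg(1-3) fg' assms(1-3) by simp
  ultimately show "f = g"
    using assms fg(1-3) fg' monic_cancel[of a f g] monic_cancel[of b f g] by auto
qed

lemma symmetric_relD:
  assumes "A \<in> Ob C" "symmetric_rel C A r" "r \<in> Ar C" "Cod C r = prod_ob C A A"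
    "h \<in> Ar C" "Cod C h = Dom C r" "r \<cdot> h = pair C z x"
    "x \<in> Ar C" "z \<in> Ar C" "Dom C x = Dom C z" "Cod C x = A" "Cod C z = A"
  obtains h' where "h' \<in> Ar C" "Dom C h' = Dom C h" "Cod C h' = Dom C r" "r \<cdot> h' = pair C x z"
proof -
  obtain s where s: "s \<in> Ar C" "Dom C s = Dom C r" "Cod C s = Dom C r"
      "r \<cdot> s = pair C (proj2 C A A \<cdot> r) (proj1 C A A \<cdot> r)"
    using assms(2) unfolding symmetric_rel_def hom_def by auto
  have "r \<cdot> (s \<cdot> h) = pair C (proj2 C A A \<cdot> r) (proj1 C A A \<cdot> r) \<cdot> h"
    by (rule comp_extend[OF s(4)]) (use s(1-3) assms in auto)
  also have "\<dots> = pair C (proj2 C A A \<cdot> (r \<cdot> h)) (proj1 C A A \<cdot> (r \<cdot> h))"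
    using assms(1,3-6) by (simp add: pair_comp)
  also have "\<dots> = pair C x z"
    using assms(1,7-12) by simp
  finally show ?thesis
    using that[of "s \<cdot> h"] s(1-3) assms(5,6) by simp
qed

lemma pair_factor:
  assumes "a \<in> Ar C" "b \<in> Ar C" "Dom C a = Dom C b" "x \<in> Ar C" "y \<in> Ar C" "Dom C x = Dom C y"
    "Cod C x = Cod C a" "Cod C y = Cod C b" "t \<in> Ar C" "Cod C t = Dom C b" "Dom C t = Dom C y"
  shows "pair C x y = pair C a b \<cdot> t \<longleftrightarrow> a \<cdot> t = x \<and> b \<cdot> t = y"
proof
  assume eq: "pair C x y = pair C a b \<cdot> t"
  have "proj1 C (Cod C a) (Cod C b) \<cdot> pair C x y = x"
    using assms by simp
  then have "x = a \<cdot> t"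
    unfolding eq using assms by simp
  moreover have "proj2 C (Cod C a) (Cod C b) \<cdot> pair C x y = y"
    using assms by simp
  then have "y = b \<cdot> t"
    unfolding eq using assms by simp
  ultimately show "a \<cdot> t = x \<and> b \<cdot> t = y" by simp
next
  assume "a \<cdot> t = x \<and> b \<cdot> t = y"
  then show "pair C x y = pair C a b \<cdot> t"
    using assms pair_comp[of a b t] by simp
qed

text \<open>On \<open>R\<close> itself, consider the relation \<open>u : S \<rightarrowtail> R \<times> R\<close> that holds of \<open>(p, q)\<close> when the
  first component of \<open>p\<close> is \<open>R\<close>-related to the second component of \<open>q\<close>. It is reflexive, hence
  symmetric. The hypotheses put \<open>(z, x)\<close> in \<open>S\<close>, with \<open>y\<close> as the witness; by symmetry \<open>(x, z)\<close> is
  in \<open>S\<close>, and its witness is \<open>t\<close>.\<close>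

lemma malcev_difunctional:
  assumes "malcev_category C"
    and ab: "a \<in> Ar C" "b \<in> Ar C" "Dom C a = Dom C b" "monic C (pair C a b)"
    and x: "x \<in> Ar C" "Dom C x = Dom C z" "Cod C x = Dom C b"
    and y: "y \<in> Ar C" "Dom C y = Dom C z" "Cod C y = Dom C b"
    and z: "z \<in> Ar C" "Cod C z = Dom C b"
    and eq: "b \<cdot> x = b \<cdot> y" "a \<cdot> y = a \<cdot> z"
  obtains t where "t \<in> Ar C" "Dom C t = Dom C z" "Cod C t = Dom C b" "a \<cdot> t = a \<cdot> x" "b \<cdot> t = b \<cdot> z"
proof -
  define R where "R = Dom C b"
  have R: "R \<in> Ob C" "Dom C a = R" "Dom C b = R"
    using ab unfolding R_def by auto
  note xyz = x(1,2) x(3)[folded R_def] y(1,2) y(3)[folded R_def] z(1) z(2)[folded R_def]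
  define k where "k = pair C (a \<cdot> proj1 C R R) (b \<cdot> proj2 C R R)"
  have k: "k \<in> Ar C" "Dom C k = prod_ob C R R" "Cod C k = prod_ob C (Cod C a) (Cod C b)"
    unfolding k_def using ab R by simp_all
  have k_pair: "k \<cdot> pair C p q = pair C (a \<cdot> p) (b \<cdot> q)"
    if "p \<in> Ar C" "q \<in> Ar C" "Dom C p = Dom C q" "Cod C p = R" "Cod C q = R" for p q
    unfolding k_def using that ab(1,2) R by (simp add: pair_comp)
  obtain u v where pb: "is_pullback C k (pair C a b) u v"
    using pullback_exists[of k "pair C a b"] k ab by (metis pair_simps(1,3))
  note pbD = pullbackD[OF pb]
  have v: "Cod C v = R"
    using pbD(8) ab R by simp
  have u: "monic C u" "Cod C u = prod_ob C R R"
    using pullback_monic[OF pb ab(4)] pbD(7) k by auto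
  have "reflexive_rel C R u"
  proof -
    have "k \<cdot> pair C (Ide C R) (Ide C R) = pair C a b \<cdot> Ide C R"
      using k_pair[of "Ide C R" "Ide C R"] ab R by simp
    then obtain d where "d \<in> Ar C" "Dom C d = R" "Cod C d = Dom C u"
        "u \<cdot> d = pair C (Ide C R) (Ide C R)"
      using pullback_lift[OF pb, of "pair C (Ide C R) (Ide C R)" "Ide C R"] R k ab
      by (metis Ide_simps pair_simps(1-3))
    then show ?thesis
      unfolding reflexive_rel_def hom_def by auto
  qed
  then have sym: "symmetric_rel C R u"
    using assms(1) u R(1) unfolding malcev_category_def equivalence_rel_def by blast
  have "k \<cdot> pair C z x = pair C a b \<cdot> y"
    using k_pair[of z x] pair_comp[of a b y] xyz ab R eq by simp
  then obtain h where h: "h \<in> Ar C" "Dom C h = Dom C z" "Cod C h = Dom C u" "u \<cdot> h = pair C z x"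
    using pullback_lift[OF pb, of "pair C z x" y] xyz k ab R by (metis pair_simps(1-3))
  obtain h' where h': "h' \<in> Ar C" "Dom C h' = Dom C h" "Cod C h' = Dom C u" "u \<cdot> h' = pair C x z"
    using symmetric_relD[OF R(1) sym, of h z x] u h xyz by auto
  have "pair C a b \<cdot> (v \<cdot> h') = k \<cdot> (u \<cdot> h')"
    using comp_extend[OF pbD(9), of h'] pbD(1,2,4-8) h'(1-3) by simp
  then have "pair C (a \<cdot> x) (b \<cdot> z) = pair C a b \<cdot> (v \<cdot> h')"
    using h'(4) k_pair[of x z] xyz by simp
  then have "a \<cdot> (v \<cdot> h') = a \<cdot> x \<and> b \<cdot> (v \<cdot> h') = b \<cdot> z"
    by (subst (asm) pair_factor) (use ab R xyz h'(1-3) h(2) pbD(5,6) v in auto)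
  then show ?thesis
    using that[of "v \<cdot> h'"] h'(1-3) h(2) pbD(5,6) v R by simp
qed

end

section \<open>Rectangular relations\<close>

context regular_cat
begin

text \<open>The hypothesis on \<open>w\<close> says that \<open>R\<^sup>\<dagger> \<circ> R\<close>, the image in \<open>A \<times> A\<close> of the kernel pair of \<open>b\<close>, is also the
  image of a product \<open>F \<times> G\<close> (a pullback over the terminal object). A loop \<open>(a x, a x)\<close> in \<open>R\<^sup>\<dagger> \<circ> R\<close>
  puts \<open>a x\<close> in both \<open>F\<close> and \<open>G\<close>. Combining the \<open>F\<close>-part of the loop at \<open>x\<close> with the
  \<open>G\<close>-part of the loop at \<open>y\<close> gives \<open>(a x, a y)\<close> in \<open>R\<^sup>\<dagger> \<circ> R\<close>. Finding the element of
  \<open>F\<close>, finding the element of \<open>G\<close> and returning to the kernel pair take one lift along a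
  regular epimorphism each, so \<open>c\<close> is a composite of three covers.\<close>

lemma bottleneck_connects:
  assumes ab: "a \<in> Ar C" "b \<in> Ar C" "Dom C a = Dom C b"
    and uv: "is_pullback C b b u v" and w1: "w \<in> im C (pair C (a \<cdot> u) (a \<cdot> v))"
    and fg: "f \<in> Ar C" "g \<in> Ar C" "Dom C f = Dom C s" "Dom C g = Dom C t"
      "Cod C f = Cod C a" "Cod C g = Cod C a"
    and pq: "is_pullback C s t p q" "Cod C s = one C"
    and w2: "w \<in> im C (pair C (f \<cdot> p) (g \<cdot> q))"
    and xy: "x \<in> Ar C" "y \<in> Ar C" "Dom C x = Dom C y" "Cod C x = Dom C b" "Cod C y = Dom C b"
  obtains c x' y' where "cover c" "Cod C c = Dom C y" "x' \<in> Ar C" "y' \<in> Ar C"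
    "Dom C x' = Dom C c" "Dom C y' = Dom C c" "Cod C x' = Dom C b" "Cod C y' = Dom C b"
    "a \<cdot> x' = a \<cdot> (x \<cdot> c)" "b \<cdot> x' = b \<cdot> y'" "a \<cdot> y' = a \<cdot> (y \<cdot> c)"
proof -
  note uvD = pullbackD[OF uv]
  note pqD = pullbackD[OF pq(1)]
  obtain e where w: "monic C w" and e: "regular_epi C e" "Cod C e = Dom C w"
      "pair C (a \<cdot> u) (a \<cdot> v) = w \<cdot> e"
    using w1 unfolding im_def by blast
  obtain e' where e': "regular_epi C e'" "Cod C e' = Dom C w" "pair C (f \<cdot> p) (g \<cdot> q) = w \<cdot> e'"
    using w2 unfolding im_def by blast
  have [simp]: "w \<in> Ar C" "e \<in> Ar C" "e' \<in> Ar C"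
    using w e e' by simp_all
  have dom_e: "Dom C e = Dom C u"
    using arg_cong[OF e(3), of "Dom C"] e(2) uvD ab by simp
  have dom_e': "Dom C e' = Dom C p"
    using arg_cong[OF e'(3), of "Dom C"] e'(2) pqD fg by simp
  have cod_w: "Cod C w = prod_ob C (Cod C a) (Cod C a)"
    using arg_cong[OF e(3), of "Cod C"] e(2) uvD ab by simp
  have A: "Cod C a \<in> Ob C" using ab by simp
  have w_e: "proj1 C (Cod C a) (Cod C a) \<cdot> (w \<cdot> (e \<cdot> h)) = a \<cdot> (u \<cdot> h)"
      "proj2 C (Cod C a) (Cod C a) \<cdot> (w \<cdot> (e \<cdot> h)) = a \<cdot> (v \<cdot> h)"
    if "h \<in> Ar C" "Cod C h = Dom C u" for h
    using comp_extend[OF e(3)[symmetric], of h] that ab uvD(4-8) e(2) dom_e by simp_all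
  have w_e': "proj1 C (Cod C a) (Cod C a) \<cdot> (w \<cdot> (e' \<cdot> h)) = f \<cdot> (p \<cdot> h)"
      "proj2 C (Cod C a) (Cod C a) \<cdot> (w \<cdot> (e' \<cdot> h)) = g \<cdot> (q \<cdot> h)"
    if "h \<in> Ar C" "Cod C h = Dom C p" for h
    using comp_extend[OF e'(3)[symmetric], of h] that fg pqD(4-8) e'(2) dom_e' by simp_all
  have ex: "\<exists>c k. regular_epi C c \<and> Cod C c = Dom C x \<and> k \<in> Ar C \<and> Dom C k = Dom C c \<and>
      Cod C k = Dom C p \<and> f \<cdot> (p \<cdot> k) = a \<cdot> (x \<cdot> c) \<and> g \<cdot> (q \<cdot> k) = a \<cdot> (x \<cdot> c)"
    if x: "x \<in> Ar C" "Cod C x = Dom C b" for x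
  proof -
    obtain h where h: "h \<in> Ar C" "Dom C h = Dom C x" "Cod C h = Dom C u" "u \<cdot> h = x" "v \<cdot> h = x"
      using pullback_lift[OF uv, of x x] x by auto
    obtain c k where c: "regular_epi C c" "Cod C c = Dom C x"
        and k: "k \<in> Ar C" "Dom C k = Dom C c" "Cod C k = Dom C p" "e' \<cdot> k = (e \<cdot> h) \<cdot> c"
      using cover_lift[OF e'(1), of "e \<cdot> h"] h(1-3) e(2) e'(2) dom_e dom_e' by auto
    have ek: "e' \<cdot> k = e \<cdot> (h \<cdot> c)"
      using k(4) h(1-3) c dom_e by simp
    have "u \<cdot> (h \<cdot> c) = x \<cdot> c" "v \<cdot> (h \<cdot> c) = x \<cdot> c"
      using comp_extend[OF h(4), of c] comp_extend[OF h(5), of c] h(1-3) c uvD(4-8) by simp_all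
    then have "f \<cdot> (p \<cdot> k) = a \<cdot> (x \<cdot> c)" "g \<cdot> (q \<cdot> k) = a \<cdot> (x \<cdot> c)"
      using w_e[of "h \<cdot> c"] w_e'[of k] ek h(1-3) c k(1-3) by simp_all
    then show ?thesis
      using c k by blast
  qed
  obtain c k where c: "regular_epi C c" "Cod C c = Dom C y" and k: "k \<in> Ar C" "Dom C k = Dom C c"
      "Cod C k = Dom C p" "f \<cdot> (p \<cdot> k) = a \<cdot> (x \<cdot> c)"
    using ex[OF xy(1,4)] xy(3) by metis
  have yc: "y \<cdot> c \<in> Ar C" "Cod C (y \<cdot> c) = Dom C b" "Dom C (y \<cdot> c) = Dom C c"
    using xy c by simp_all
  obtain d l where d: "regular_epi C d" "Cod C d = Dom C c" and l: "l \<in> Ar C" "Dom C l = Dom C d"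
      "Cod C l = Dom C p" "g \<cdot> (q \<cdot> l) = a \<cdot> ((y \<cdot> c) \<cdot> d)"
    using ex[OF yc(1,2)] yc(3) by metis
  have [simp]: "c \<in> Ar C" "d \<in> Ar C" using c d by simp_all
  \<comment> \<open>\<open>k\<close> and \<open>l\<close> lie over the loops at \<open>x\<close> and \<open>y\<close>; the \<open>F\<close>-part of \<open>k\<close> and the \<open>G\<close>-part of \<open>l\<close>
    are compatible because they only have to agree in the terminal object\<close>
  have "s \<cdot> (p \<cdot> (k \<cdot> d)) = t \<cdot> (q \<cdot> l)"
    by (rule to_one_unique) (use pqD(1-8) pq(2) k(1-3) l(1-3) d(2) in auto)
  then obtain h where h: "h \<in> Ar C" "Dom C h = Dom C d" "Cod C h = Dom C p"
      "p \<cdot> h = p \<cdot> (k \<cdot> d)" "q \<cdot> h = q \<cdot> l"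
    using pullback_lift[OF pq(1), of "p \<cdot> (k \<cdot> d)" "q \<cdot> l"] pqD(4-8) k(1-3) l(1-3) d(2) by auto
  obtain c' m where c': "regular_epi C c'" "Cod C c' = Dom C d"
      and m: "m \<in> Ar C" "Dom C m = Dom C c'" "Cod C m = Dom C u" "e \<cdot> m = (e' \<cdot> h) \<cdot> c'"
    using cover_lift[OF e(1), of "e' \<cdot> h"] h(1-3) e(2) e'(2) dom_e dom_e' by auto
  have [simp]: "c' \<in> Ar C" using c' by simp
  have em: "e \<cdot> m = e' \<cdot> (h \<cdot> c')"
    using m(4) h(1-3) c' dom_e' by simp
  have ph: "p \<cdot> (h \<cdot> c') = p \<cdot> (k \<cdot> (d \<cdot> c'))"
    using comp_extend[OF h(4), of c'] h(1-3) pqD(4-8) k(1-3) d(2) c'(2) by simp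
  have qh: "q \<cdot> (h \<cdot> c') = q \<cdot> (l \<cdot> c')"
    using comp_extend[OF h(5), of c'] h(1-3) pqD(4-8) l(1-3) d(2) c'(2) by simp
  have fk: "f \<cdot> (p \<cdot> (k \<cdot> (d \<cdot> c'))) = a \<cdot> (x \<cdot> (c \<cdot> (d \<cdot> c')))"
    using comp_extend[OF k(4), of "d \<cdot> c'"] fg(1,3) pqD(4-8) k(1-3) c(2) d(2) c'(2) xy ab by simp
  have gl: "g \<cdot> (q \<cdot> (l \<cdot> c')) = a \<cdot> (y \<cdot> (c \<cdot> (d \<cdot> c')))"
    using comp_extend[OF l(4), of c'] fg(2,4) pqD(4-8) l(1-3) c(2) d(2) c'(2) xy ab by simp
  have "a \<cdot> (u \<cdot> m) = a \<cdot> (x \<cdot> (c \<cdot> (d \<cdot> c')))" "a \<cdot> (v \<cdot> m) = a \<cdot> (y \<cdot> (c \<cdot> (d \<cdot> c')))"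
    using w_e[OF m(1,3)] w_e'[of "h \<cdot> c'"] em ph qh fk gl h(1-3) c'(2) by simp_all
  moreover have "b \<cdot> (u \<cdot> m) = b \<cdot> (v \<cdot> m)"
    using comp_extend[OF uvD(9), of m] m(1-3) uvD(1-8) by simp
  moreover have "cover (c \<cdot> (d \<cdot> c'))"
    using c d c' by (simp add: cover_comp regular_epi_cover)
  ultimately show ?thesis
    using that[of "c \<cdot> (d \<cdot> c')" "u \<cdot> m" "v \<cdot> m"] c(2) d(2) c'(2) m(1-3) uvD(4-8) by simp
qed

text \<open>Difunctionality is applied to the zigzag \<open>x'\<close>, \<open>y'\<close>, \<open>y \<cdot> c\<close> over the cover \<open>c\<close>, and the
  resulting membership of \<open>(a x, b y)\<close> descends along \<open>c\<close>.\<close>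

lemma connected_rectangle:
  assumes malcev: "malcev_category C"
    and ab: "a \<in> Ar C" "b \<in> Ar C" "Dom C a = Dom C b" "monic C (pair C a b)"
    and conn: "\<And>x y. x \<in> Ar C \<Longrightarrow> y \<in> Ar C \<Longrightarrow> Dom C x = Dom C y \<Longrightarrow> Cod C x = Dom C b \<Longrightarrow>
      Cod C y = Dom C b \<Longrightarrow>
      \<exists>c x' y'. cover c \<and> Cod C c = Dom C y \<and> x' \<in> Ar C \<and> y' \<in> Ar C \<and>
        Dom C x' = Dom C c \<and> Dom C y' = Dom C c \<and> Cod C x' = Dom C b \<and> Cod C y' = Dom C b \<and>
        a \<cdot> x' = a \<cdot> (x \<cdot> c) \<and> b \<cdot> x' = b \<cdot> y' \<and> a \<cdot> y' = a \<cdot> (y \<cdot> c)"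
    and xy: "x \<in> Ar C" "y \<in> Ar C" "Dom C x = Dom C y" "Cod C x = Dom C b" "Cod C y = Dom C b"
  shows "\<exists>t\<in>Ar C. Dom C t = Dom C y \<and> Cod C t = Dom C b \<and> a \<cdot> t = a \<cdot> x \<and> b \<cdot> t = b \<cdot> y"
proof -
  obtain c x' y' where c: "cover c" "Cod C c = Dom C y"
      and x': "x' \<in> Ar C" "Dom C x' = Dom C c" "Cod C x' = Dom C b" "a \<cdot> x' = a \<cdot> (x \<cdot> c)"
      and y': "y' \<in> Ar C" "Dom C y' = Dom C c" "Cod C y' = Dom C b" "a \<cdot> y' = a \<cdot> (y \<cdot> c)"
      and b: "b \<cdot> x' = b \<cdot> y'"
    using conn[OF xy] by blast
  have yc: "y \<cdot> c \<in> Ar C" "Dom C (y \<cdot> c) = Dom C c" "Cod C (y \<cdot> c) = Dom C b"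
    using xy c by simp_all
  obtain t where t: "t \<in> Ar C" "Dom C t = Dom C c" "Cod C t = Dom C b"
      "a \<cdot> t = a \<cdot> (x \<cdot> c)" "b \<cdot> t = b \<cdot> (y \<cdot> c)"
    using malcev_difunctional[OF malcev ab x'(1) _ x'(3) y'(1) _ y'(3) yc(1,3) b y'(4)]
      x'(2,4) y'(2) yc(2) by metis
  have "pair C (a \<cdot> x) (b \<cdot> y) \<cdot> c = pair C a b \<cdot> t"
    using t ab xy c by (simp add: pair_comp)
  then have "factors_through C (pair C (a \<cdot> x) (b \<cdot> y) \<cdot> c) (pair C a b)"
    unfolding factors_iff using t(1-3) ab xy c by (intro bexI[of _ t]) auto
  then have "factors_through C (pair C (a \<cdot> x) (b \<cdot> y)) (pair C a b)"
    by (rule cover_descend) (use c ab xy in auto)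
  then obtain k where k: "k \<in> Ar C" "Dom C k = Dom C y" "Cod C k = Dom C b"
      "pair C (a \<cdot> x) (b \<cdot> y) = pair C a b \<cdot> k"
    unfolding factors_iff using ab xy by auto
  then have "a \<cdot> k = a \<cdot> x \<and> b \<cdot> k = b \<cdot> y"
    by (subst (asm) pair_factor) (use ab xy in auto)
  then show ?thesis
    using k by blast
qed

text \<open>A span closed under mixing components fills the product of the ranges \<open>m\<close> and \<open>n\<close> of its
  legs. Composites in \<open>Rel C\<close> range over all representatives, so the product is formed from
  arrows \<open>f\<close> and \<open>g\<close> that are merely equivalent to \<open>m\<close> and \<open>n\<close>. The comparison \<open>k\<close> from the
  product to the span is split by \<open>h\<close>, which makes it a regular epimorphism and the span the
  image of the product.\<close>

lemma rectangle_im: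
  assumes ab: "a \<in> Ar C" "b \<in> Ar C" "Dom C a = Dom C b" "monic C (pair C a b)"
    and rect: "\<And>x y. x \<in> Ar C \<Longrightarrow> y \<in> Ar C \<Longrightarrow> Dom C x = Dom C y \<Longrightarrow> Cod C x = Dom C b \<Longrightarrow>
      Cod C y = Dom C b \<Longrightarrow>
      \<exists>t\<in>Ar C. Dom C t = Dom C y \<and> Cod C t = Dom C b \<and> a \<cdot> t = a \<cdot> x \<and> b \<cdot> t = b \<cdot> y"
    and m: "regular_epi C d" "m \<in> Ar C" "Cod C d = Dom C m" "a = m \<cdot> d"
    and n: "regular_epi C e" "n \<in> Ar C" "Cod C e = Dom C n" "b = n \<cdot> e"
    and f: "f \<in> Ar C" "factors_through C f m" "factors_through C m f"
    and g: "g \<in> Ar C" "factors_through C g n" "factors_through C n g"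
    and uv: "is_pullback C s t u v" "Dom C s = Dom C f" "Dom C t = Dom C g" "Cod C s = one C"
  shows "im C (pair C (f \<cdot> u) (g \<cdot> v)) = sub_class C (pair C a b)"
proof -
  note uvD = pullbackD[OF uv(1)]
  have [simp]: "d \<in> Ar C" "e \<in> Ar C" using m n by simp_all
  have dom: "Dom C d = Dom C b" "Dom C e = Dom C b"
    using ab(3) arg_cong[OF m(4), of "Dom C"] arg_cong[OF n(4), of "Dom C"] m(2,3) n(2,3) by simp_all
  have cod: "Cod C a = Cod C m" "Cod C b = Cod C n"
    using arg_cong[OF m(4), of "Cod C"] arg_cong[OF n(4), of "Cod C"] m(2,3) n(2,3) by simp_all
  obtain i where i: "i \<in> Ar C" "Dom C i = Dom C m" "Cod C i = Dom C f" "f \<cdot> i = m"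
    using f(3) unfolding factors_iff by metis
  obtain j where j: "j \<in> Ar C" "Dom C j = Dom C n" "Cod C j = Dom C g" "g \<cdot> j = n"
    using g(3) unfolding factors_iff by metis
  obtain i' where i': "i' \<in> Ar C" "Dom C i' = Dom C f" "Cod C i' = Dom C m" "m \<cdot> i' = f"
    using f(2) unfolding factors_iff by metis
  obtain j' where j': "j' \<in> Ar C" "Dom C j' = Dom C g" "Cod C j' = Dom C n" "n \<cdot> j' = g"
    using g(2) unfolding factors_iff by metis
  have cod': "Cod C f = Cod C a" "Cod C g = Cod C b"
    using arg_cong[OF i(4), of "Cod C"] arg_cong[OF j(4), of "Cod C"] i(1-3) j(1-3) f(1) g(1) cod
    by simp_all
  \<comment> \<open>the span factors through the product of its images\<close>
  have "s \<cdot> (i \<cdot> d) = t \<cdot> (j \<cdot> e)"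
    by (rule to_one_unique) (use i(1-3) j(1-3) uv(2-4) uvD(1-3) m(3) n(3) dom in auto)
  then obtain h where h: "h \<in> Ar C" "Dom C h = Dom C b" "Cod C h = Dom C u"
      "u \<cdot> h = i \<cdot> d" "v \<cdot> h = j \<cdot> e"
    using pullback_lift[OF uv(1), of "i \<cdot> d" "j \<cdot> e"] i(1-3) j(1-3) uv(2,3) m(3) n(3) dom by auto
  have h_a: "f \<cdot> (u \<cdot> h) = a"
    unfolding h(4) m(4) by (rule comp_extend[OF i(4)]) (use i(1-3) f(1) m(3) in auto)
  have h_b: "g \<cdot> (v \<cdot> h) = b"
    unfolding h(5) n(4) by (rule comp_extend[OF j(4)]) (use j(1-3) g(1) n(3) in auto)
  \<comment> \<open>an element of the product of the images lifts, over a cover, to a pair of elements of the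
    span; \<open>rect\<close> merges this pair into one element\<close>
  obtain c x where c: "regular_epi C c" "Cod C c = Dom C u"
      and x: "x \<in> Ar C" "Dom C x = Dom C c" "Cod C x = Dom C b" "d \<cdot> x = (i' \<cdot> u) \<cdot> c"
    using cover_lift[OF m(1), of "i' \<cdot> u"] i'(1-3) uvD(4-8) uv(2,3) m(3) dom by auto
  have [simp]: "c \<in> Ar C" using c by simp
  obtain c' y where c': "regular_epi C c'" "Cod C c' = Dom C c"
      and y: "y \<in> Ar C" "Dom C y = Dom C c'" "Cod C y = Dom C b" "e \<cdot> y = (j' \<cdot> (v \<cdot> c)) \<cdot> c'"
    using cover_lift[OF n(1), of "j' \<cdot> (v \<cdot> c)"] j'(1-3) c uvD(4-8) uv(2,3) n(3) dom by auto
  have [simp]: "c' \<in> Ar C" using c' by simp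
  obtain l where l: "l \<in> Ar C" "Dom C l = Dom C y" "Cod C l = Dom C b"
      "a \<cdot> l = a \<cdot> (x \<cdot> c')" "b \<cdot> l = b \<cdot> y"
    using rect[of "x \<cdot> c'" y] x(1-3) y(1-3) c' by auto
  have "a \<cdot> (x \<cdot> c') = m \<cdot> (d \<cdot> (x \<cdot> c'))"
    unfolding m(4) using m(2,3) x(1-3) dom c'(2) by simp
  also have "d \<cdot> (x \<cdot> c') = i' \<cdot> (u \<cdot> (c \<cdot> c'))"
    using comp_extend[OF x(4), of c'] x(1-3) dom c(2) c'(2) i'(1-3) uvD(4-8) uv(2,3) by simp
  also have "m \<cdot> (i' \<cdot> (u \<cdot> (c \<cdot> c'))) = f \<cdot> (u \<cdot> (c \<cdot> c'))"
    by (rule comp_extend[OF i'(4)]) (use m(2) i'(1-3) uvD(4-8) uv(2,3) c(2) c'(2) in auto)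
  finally have al: "a \<cdot> l = f \<cdot> (u \<cdot> (c \<cdot> c'))"
    using l(4) by simp
  have "b \<cdot> y = n \<cdot> (e \<cdot> y)"
    unfolding n(4) using n(2,3) y(1-3) dom by simp
  also have "e \<cdot> y = j' \<cdot> (v \<cdot> (c \<cdot> c'))"
    using y(4) c(2) c'(2) j'(1-3) uvD(4-8) uv(2,3) by simp
  also have "n \<cdot> (j' \<cdot> (v \<cdot> (c \<cdot> c'))) = g \<cdot> (v \<cdot> (c \<cdot> c'))"
    by (rule comp_extend[OF j'(4)]) (use n(2) j'(1-3) uvD(4-8) uv(2,3) c(2) c'(2) in auto)
  finally have bl: "b \<cdot> l = g \<cdot> (v \<cdot> (c \<cdot> c'))"
    using l(5) by simp
  let ?fg = "pair C (f \<cdot> u) (g \<cdot> v)"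
  have fu: "f \<cdot> u \<in> Ar C" "Dom C (f \<cdot> u) = Dom C u" "Cod C (f \<cdot> u) = Cod C a"
    and gv: "g \<cdot> v \<in> Ar C" "Dom C (g \<cdot> v) = Dom C u" "Cod C (g \<cdot> v) = Cod C b"
    using f(1) g(1) uvD(4-8) uv(2,3) cod' by simp_all
  have "?fg \<cdot> (c \<cdot> c') = pair C (f \<cdot> (u \<cdot> (c \<cdot> c'))) (g \<cdot> (v \<cdot> (c \<cdot> c')))"
    using fu gv c(2) c'(2) f(1) g(1) uvD(4-8) uv(2,3) by (simp add: pair_comp)
  also have "\<dots> = pair C a b \<cdot> l"
    using al bl l(1-3) ab by (simp add: pair_comp)
  finally have "factors_through C (?fg \<cdot> (c \<cdot> c')) (pair C a b)"
    unfolding factors_iff using l(1-3) y(2) fu gv c(2) c'(2) ab by (intro bexI[of _ l]) auto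
  then have "factors_through C ?fg (pair C a b)"
    by (rule cover_descend[OF _ cover_comp])
       (use c c' fu gv ab in \<open>auto simp: regular_epi_cover\<close>)
  then obtain k where k: "k \<in> Ar C" "Dom C k = Dom C u" "Cod C k = Dom C b" "?fg = pair C a b \<cdot> k"
    unfolding factors_iff using fu gv ab by auto
  have k': "a \<cdot> k = f \<cdot> u" "b \<cdot> k = g \<cdot> v"
    using k(4) pair_factor[of a b "f \<cdot> u" "g \<cdot> v" k] ab fu gv k(1-3) by auto
  have "a \<cdot> (k \<cdot> h) = a" "b \<cdot> (k \<cdot> h) = b"
    using comp_extend[OF k'(1), of h] comp_extend[OF k'(2), of h] h_a h_b k(1-3) h(1-3)
      ab f(1) g(1) uvD(4-8) uv(2,3) by simp_all
  then have "pair C a b \<cdot> (k \<cdot> h) = pair C a b \<cdot> Ide C (Dom C b)"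
    using ab k(1-3) h(1-3) by (simp add: pair_comp)
  then have "k \<cdot> h = Ide C (Dom C b)"
    by (rule monic_cancel) (use ab k(1-3) h(1-3) in auto)
  then have "regular_epi C k"
    using split_epi_regular[of k h] k(1-3) h(1-3) by simp
  then show ?thesis
    unfolding k(4) using ab k(3) by (intro im_eq_sub_class) auto
qed


section \<open>States and daggers in the category of relations\<close>

text \<open>Composite and dagger are unions over all representatives. If every choice gives the same
  subobject \<open>U\<close>, it remains to exhibit one choice, so that the union is not
  empty.\<close>

lemma rel_comp_dagger_states:
  assumes ob: "A \<in> Ob C" "B \<in> Ob C"
    and m: "monic C m" "Cod C m = A" and n: "monic C n" "Cod C n = B"
    and tm: "tm \<in> Ar C" "Dom C tm = Dom C m" "Cod C tm = one C"
    and tn: "tn \<in> Ar C" "Dom C tn = Dom C n" "Cod C tn = one C"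
    and im: "\<And>f g s t u v. f \<in> Ar C \<Longrightarrow> factors_through C f m \<Longrightarrow> factors_through C m f \<Longrightarrow>
      g \<in> Ar C \<Longrightarrow> factors_through C g n \<Longrightarrow> factors_through C n g \<Longrightarrow>
      is_pullback C s t u v \<Longrightarrow> Dom C s = Dom C f \<Longrightarrow> Dom C t = Dom C g \<Longrightarrow> Cod C s = one C \<Longrightarrow>
      im C (pair C (f \<cdot> u) (g \<cdot> v)) = U"
  shows "rel_comp C (one C, B, sub_class C (pair C tn n))
      (rel_dagger C (one C, A, sub_class C (pair C tm m))) = (A, B, U)"
proof -
  let ?I = "one C"
  let ?U = "\<Union>{sub_class C (pair C (proj2 C ?I A \<cdot> r) (proj1 C ?I A \<cdot> r)) | r.
    r \<in> sub_class C (pair C tm m)}"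
  have [simp]: "m \<in> Ar C" "n \<in> Ar C" using m n by simp_all
  have mon: "monic C (pair C tm m)" "monic C (pair C tn n)" "monic C (pair C m tm)"
    using m n tm tn by (simp_all add: monic_pair)
  have q: "q \<in> Ar C \<and> Cod C q = prod_ob C A ?I \<and> factors_through C (proj1 C A ?I \<cdot> q) m \<and>
      factors_through C m (proj1 C A ?I \<cdot> q)" if qU: "q \<in> ?U" for q
  proof -
    obtain r where "r \<in> sub_class C (pair C tm m)"
        and q: "q \<in> sub_class C (pair C (proj2 C ?I A \<cdot> r) (proj1 C ?I A \<cdot> r))"
      using qU by blast
    note r = sub_classD[OF this(1)] and q = sub_classD[OF q]
    have codr: "r \<in> Ar C" "Cod C r = prod_ob C ?I A" using r tm m by simp_all
    have "factors_through C (proj2 C ?I A \<cdot> r) m" "factors_through C m (proj2 C ?I A \<cdot> r)"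
      using factors_postcomp[OF r(3), of "proj2 C ?I A"] factors_postcomp[OF r(4), of "proj2 C ?I A"]
        codr tm m ob by simp_all
    moreover have "factors_through C (proj1 C A ?I \<cdot> q) (proj2 C ?I A \<cdot> r)"
        "factors_through C (proj2 C ?I A \<cdot> r) (proj1 C A ?I \<cdot> q)"
      using factors_postcomp[OF q(3), of "proj1 C A ?I"] factors_postcomp[OF q(4), of "proj1 C A ?I"]
        q(1,2) codr ob by simp_all
    moreover have "q \<in> Ar C" "Cod C q = prod_ob C A ?I"
      using q(1,2) codr ob by simp_all
    ultimately show ?thesis
      using ob codr by (auto intro: factors_trans)
  qed
  have s: "s \<in> Ar C \<and> Cod C s = prod_ob C ?I B \<and> factors_through C (proj2 C ?I B \<cdot> s) n \<and>
      factors_through C n (proj2 C ?I B \<cdot> s)" if "s \<in> sub_class C (pair C tn n)" for s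
    using sub_classD[OF that] factors_postcomp[of s "pair C tn n" "proj2 C ?I B"]
      factors_postcomp[of "pair C tn n" s "proj2 C ?I B"] ob tn n by simp
  have comp: "im C (pair C (proj1 C A ?I \<cdot> q \<cdot> u) (proj2 C ?I B \<cdot> s \<cdot> v)) = U"
    if "q \<in> ?U" "s \<in> sub_class C (pair C tn n)"
      "is_pullback C (proj2 C A ?I \<cdot> q) (proj1 C ?I B \<cdot> s) u v" for q s u v
    by (rule im[OF _ _ _ _ _ _ that(3)]) (use q[OF that(1)] s[OF that(2)] ob in auto)
  have "pair C m tm \<in> sub_class C (pair C (proj2 C ?I A \<cdot> pair C tm m) (proj1 C ?I A \<cdot> pair C tm m))"
    using sub_class_self[OF mon(3)] tm m by simp
  then have q0: "pair C m tm \<in> ?U"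
    using sub_class_self[OF mon(1)] by blast
  have s0: "pair C tn n \<in> sub_class C (pair C tn n)"
    using sub_class_self[OF mon(2)] .
  obtain u v where uv: "is_pullback C (proj2 C A ?I \<cdot> pair C m tm) (proj1 C ?I B \<cdot> pair C tn n) u v"
    using pullback_exists[of "proj2 C A ?I \<cdot> pair C m tm" "proj1 C ?I B \<cdot> pair C tn n"] m n tm tn
    by auto
  have "{im C (pair C (proj1 C A ?I \<cdot> q \<cdot> u) (proj2 C ?I B \<cdot> s \<cdot> v)) | q s u v.
      q \<in> ?U \<and> s \<in> sub_class C (pair C tn n) \<and>
      is_pullback C (proj2 C A ?I \<cdot> q) (proj1 C ?I B \<cdot> s) u v} = {U}" (is "?S = _")
  proof
    show "?S \<subseteq> {U}" using comp by blast
    show "{U} \<subseteq> ?S" using comp[OF q0 s0 uv] q0 s0 uv by blast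
  qed
  then show ?thesis
    unfolding rel_comp_def rel_dagger_def by simp
qed

lemma state_in_Rel:
  assumes "monic C m" "t \<in> Ar C" "Dom C t = Dom C m" "Cod C t = one C"
  shows "(one C, Cod C m, sub_class C (pair C t m)) \<in> hom (Rel C) (one C) (Cod C m)"
  using assms monic_pair[of t m] unfolding Rel_def hom_def subobjects_def
  by auto

text \<open>Choosing \<open>pair C a b\<close> and its transpose as representatives exhibits the image in \<open>A \<times> A\<close>
  of the kernel pair of \<open>b\<close> inside \<open>R\<^sup>\<dagger> \<circ> R\<close>.\<close>

lemma rel_dagger_comp_self:
  assumes ab: "a \<in> Ar C" "b \<in> Ar C" "Dom C a = Dom C b" "monic C (pair C a b)"
    and A: "A = Cod C a" and B: "B = Cod C b"
  obtains u v where "is_pullback C b b u v"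
    "im C (pair C (a \<cdot> u) (a \<cdot> v)) \<subseteq>
      snd (snd (rel_comp C (rel_dagger C (A, B, sub_class C (pair C a b))) (A, B, sub_class C (pair C a b))))"
proof -
  obtain u v where uv: "is_pullback C b b u v"
    using pullback_exists[OF ab(2,2)] by blast
  let ?r = "pair C a b"
  let ?V = "\<Union>{sub_class C (pair C (proj2 C A B \<cdot> r) (proj1 C A B \<cdot> r)) | r. r \<in> sub_class C ?r}"
  have ba: "monic C (pair C b a)"
  proof (rule monicI)
    fix f g
    assume fg: "f \<in> Ar C" "g \<in> Ar C" "Dom C f = Dom C g" "Cod C f = Dom C (pair C b a)"
      "Cod C g = Dom C (pair C b a)" and eq: "pair C b a \<cdot> f = pair C b a \<cdot> g"
    have fg': "Cod C f = Dom C b" "Cod C g = Dom C b"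
      using fg ab by simp_all
    have "b \<cdot> f = b \<cdot> g" "a \<cdot> f = a \<cdot> g"
      using arg_cong[OF eq, of "\<lambda>h. proj1 C B A \<cdot> h"] arg_cong[OF eq, of "\<lambda>h. proj2 C B A \<cdot> h"]
        fg(1-3) fg' ab(1-3) A B by simp_all
    then have "?r \<cdot> f = ?r \<cdot> g"
      using fg(1-3) fg' ab(1-3) by (simp add: pair_comp)
    then show "f = g"
      by (rule monic_cancel) (use fg(1-3) fg' ab in auto)
  qed (use ab in simp)
  have r: "?r \<in> sub_class C ?r"
    using sub_class_self[OF ab(4)] .
  have "pair C b a \<in> sub_class C (pair C (proj2 C A B \<cdot> ?r) (proj1 C A B \<cdot> ?r))"
    using sub_class_self[OF ba] ab A B by simp
  then have s: "pair C b a \<in> ?V"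
    using r by blast
  have "proj2 C A B \<cdot> ?r = b" "proj1 C B A \<cdot> pair C b a = b"
    "proj1 C A B \<cdot> ?r = a" "proj2 C B A \<cdot> pair C b a = a"
    using ab A B by simp_all
  then have "im C (pair C (a \<cdot> u) (a \<cdot> v)) \<in>
      {im C (pair C (proj1 C A B \<cdot> r \<cdot> u) (proj2 C B A \<cdot> s \<cdot> v)) | r s u v.
         r \<in> sub_class C ?r \<and> s \<in> ?V \<and> is_pullback C (proj2 C A B \<cdot> r) (proj1 C B A \<cdot> s) u v}"
    using r s uv by force
  from that[OF uv, unfolded rel_comp_def rel_dagger_def prod.case snd_conv, OF Union_upper[OF this]]
  show ?thesis .
qed

text \<open>Conversely to \<open>rel_comp_dagger_states\<close>, whichever representatives of the states produce \<open>w\<close>,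
  the arrow \<open>w\<close> represents the image of a product of two arrows into \<open>A\<close>.\<close>

lemma rel_comp_dagger_statesD:
  assumes ob: "A \<in> Ob C"
    and phi: "\<phi> \<in> hom (Rel C) (one C) A" and psi: "\<psi> \<in> hom (Rel C) (one C) A"
    and w: "w \<in> snd (snd (rel_comp C \<psi> (rel_dagger C \<phi>)))"
  obtains f g s t p q where "f \<in> Ar C" "g \<in> Ar C" "Dom C f = Dom C s" "Dom C g = Dom C t"
    "Cod C f = A" "Cod C g = A" "is_pullback C s t p q" "Cod C s = one C"
    "w \<in> im C (pair C (f \<cdot> p) (g \<cdot> q))"
proof -
  let ?I = "one C"
  obtain U m where U: "\<phi> = (?I, A, U)" "U = sub_class C m" "monic C m" "Cod C m = prod_ob C ?I A"
    using phi unfolding hom_def Rel_def subobjects_def by auto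
  obtain V n where V: "\<psi> = (?I, A, V)" "V = sub_class C n" "monic C n" "Cod C n = prod_ob C ?I A"
    using psi unfolding hom_def Rel_def subobjects_def by auto
  obtain r q s u v where r: "r \<in> U"
      and q: "q \<in> sub_class C (pair C (proj2 C ?I A \<cdot> r) (proj1 C ?I A \<cdot> r))"
      and s: "s \<in> V" and pb: "is_pullback C (proj2 C A ?I \<cdot> q) (proj1 C ?I A \<cdot> s) u v"
      and w: "w \<in> im C (pair C (proj1 C A ?I \<cdot> q \<cdot> u) (proj2 C ?I A \<cdot> s \<cdot> v))"
    using w unfolding U(1) V(1) rel_comp_def rel_dagger_def by auto
  note r = sub_classD[OF r[unfolded U(2)]] and q = sub_classD[OF q]
    and s = sub_classD[OF s[unfolded V(2)]]
  have "r \<in> Ar C" "Cod C r = prod_ob C ?I A" "s \<in> Ar C" "Cod C s = prod_ob C ?I A"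
    using r s U V by simp_all
  moreover from this have "q \<in> Ar C" "Cod C q = prod_ob C A ?I"
    using q ob by simp_all
  ultimately show ?thesis
    using that[OF _ _ _ _ _ _ pb _ w] ob by simp
qed


section \<open>The bottleneck principle\<close>

text \<open>A common representative \<open>w\<close> of both sides of the hypothesis makes
  \<open>bottleneck_connects\<close> applicable to the legs of \<open>R\<close>. The states of the conclusion are the
  images of those legs, as the domain and the range of \<open>R\<close>.\<close>

lemma bottleneck_principle_Rel:
  assumes malcev: "malcev_category C"
  shows "bottleneck_principle (Rel C) (rel_dagger C) (one C)"
  unfolding bottleneck_principle_def
proof (intro ballI impI)
  fix A B R
  assume "A \<in> Ob (Rel C)" "B \<in> Ob (Rel C)" and R: "R \<in> hom (Rel C) A B"
    and "\<exists>\<psi>\<in>hom (Rel C) (one C) A. \<exists>\<phi>\<in>hom (Rel C) (one C) A.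
      rel_dagger C R \<cdot>\<^bsub>Rel C\<^esub> R = \<psi> \<cdot>\<^bsub>Rel C\<^esub> rel_dagger C \<phi>"
  then obtain \<phi> \<psi> where ob: "A \<in> Ob C" "B \<in> Ob C" and phi: "\<phi> \<in> hom (Rel C) (one C) A"
      and psi: "\<psi> \<in> hom (Rel C) (one C) A"
      and eq: "rel_comp C (rel_dagger C R) R = rel_comp C \<psi> (rel_dagger C \<phi>)"
    by (auto simp: Rel_def)
  obtain r where r: "R = (A, B, sub_class C r)" "monic C r" "Cod C r = prod_ob C A B"
    using R unfolding hom_def Rel_def subobjects_def by auto
  define a b where "a = proj1 C A B \<cdot> r" and "b = proj2 C A B \<cdot> r"
  have r_ab: "pair C a b = r"
    unfolding a_def b_def using r ob by (intro pair_proj) auto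
  have ab: "a \<in> Ar C" "b \<in> Ar C" "Dom C a = Dom C b" "monic C (pair C a b)"
      and cod: "Cod C a = A" "Cod C b = B"
    unfolding r_ab using r ob by (simp_all add: a_def b_def)
  obtain u v where uv: "is_pullback C b b u v"
      and sub: "im C (pair C (a \<cdot> u) (a \<cdot> v)) \<subseteq> snd (snd (rel_comp C (rel_dagger C R) R))"
    using rel_dagger_comp_self[OF ab cod[symmetric]] unfolding r_ab r(1)[symmetric] by metis
  have "pair C (a \<cdot> u) (a \<cdot> v) \<in> Ar C"
    using pullbackD[OF uv] ab by simp
  then obtain w where w: "w \<in> im C (pair C (a \<cdot> u) (a \<cdot> v))"
    using image_factorization unfolding im_def by blast
  then have "w \<in> snd (snd (rel_comp C \<psi> (rel_dagger C \<phi>)))"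
    using sub eq by auto
  then obtain f g s t p q where fg: "f \<in> Ar C" "g \<in> Ar C" "Dom C f = Dom C s" "Dom C g = Dom C t"
      "Cod C f = Cod C a" "Cod C g = Cod C a" and pq: "is_pullback C s t p q" "Cod C s = one C"
      and w': "w \<in> im C (pair C (f \<cdot> p) (g \<cdot> q))"
    using rel_comp_dagger_statesD[OF ob(1) phi psi] cod(1) by metis
  have rect: "\<exists>t\<in>Ar C. Dom C t = Dom C y \<and> Cod C t = Dom C b \<and> a \<cdot> t = a \<cdot> x \<and> b \<cdot> t = b \<cdot> y"
    if "x \<in> Ar C" "y \<in> Ar C" "Dom C x = Dom C y" "Cod C x = Dom C b" "Cod C y = Dom C b" for x y
    by (rule connected_rectangle[OF malcev ab _ that])
       (rule bottleneck_connects[OF ab(1-3) uv w fg pq w'], assumption+, blast)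
  obtain m d where m: "monic C m" "regular_epi C d" "Cod C d = Dom C m" "a = m \<cdot> d"
    using image_factorization[OF ab(1)] .
  obtain n e where n: "monic C n" "regular_epi C e" "Cod C e = Dom C n" "b = n \<cdot> e"
    using image_factorization[OF ab(2)] .
  have cod_mn: "Cod C m = A" "Cod C n = B"
    using arg_cong[OF m(4), of "Cod C"] arg_cong[OF n(4), of "Cod C"] cod m(1-3) n(1-3) by simp_all
  obtain tm where tm: "tm \<in> Ar C" "Dom C tm = Dom C m" "Cod C tm = one C"
    using to_one_exists[of "Dom C m"] m(1) by auto
  obtain tn where tn: "tn \<in> Ar C" "Dom C tn = Dom C n" "Cod C tn = one C"
    using to_one_exists[of "Dom C n"] n(1) by auto
  have "rel_comp C (one C, B, sub_class C (pair C tn n))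
      (rel_dagger C (one C, A, sub_class C (pair C tm m))) = R"
    unfolding r(1) r_ab[symmetric]
    by (rule rel_comp_dagger_states[OF ob m(1) cod_mn(1) n(1) cod_mn(2) tm tn],
        rule rectangle_im[OF ab rect m(2) monic_Ar[OF m(1)] m(3,4) n(2) monic_Ar[OF n(1)] n(3,4)])
  moreover have "(one C, A, sub_class C (pair C tm m)) \<in> hom (Rel C) (one C) A"
      "(one C, B, sub_class C (pair C tn n)) \<in> hom (Rel C) (one C) B"
    using state_in_Rel[OF m(1) tm] state_in_Rel[OF n(1) tn] cod_mn by simp_all
  ultimately show "\<exists>\<phi>\<in>hom (Rel C) (one C) A. \<exists>\<psi>\<in>hom (Rel C) (one C) B.
      R = \<psi> \<cdot>\<^bsub>Rel C\<^esub> rel_dagger C \<phi>"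
    by (force simp: Rel_def)
qed

end

theorem lemma5p9:
  fixes C :: "('o, 'a) cat"
  assumes "regular_category C" and "malcev_category C"
  shows "bottleneck_principle (Rel C) (rel_dagger C) (one C)"
proof -
  interpret category C
    using assms(1) by (simp add: regular_category_def)
  interpret regular_cat C
    by unfold_locales (use assms(1) in \<open>auto simp: regular_category_def\<close>)
  show ?thesis
    using assms(2) by (rule bottleneck_principle_Rel)
qed

end
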